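(* Let $p$ be an odd prime and $n$ an integer with $\gcd(n,p)=1$. Then $$\sum_{\chi \bmod p}|G(n,\chi;p)|^6=\begin{cases}10p^4+O(p^{7/2}), & p\equiv 1\pmod 4,\\ (p-1)(10p^3-25p^2-4p-1), & p\equiv 3\pmod 4,\end{cases}$$ where the sum is over all Dirichlet characters modulo $p$ and the implied constant is absolute.
   Context: For a prime $p$, an integer $n$ and a Dirichlet character $\chi$ modulo $p$, the generalized quadratic Gauss sum is $G(n,\chi;p)=\sum_{a=1}^{p}\chi(a)e\!\left(\frac{na^2}{p}\right)$ with $e(y)=e^{2\pi i y}$. *)

theory Defs
  imports Complex_Main "HOL-Computational_Algebra.Primes"
begin

definition dirichlet_character :: "nat \<Rightarrow> (nat \<Rightarrow> complex) \<Rightarrow> bool" where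
  "dirichlet_character m \<chi> \<longleftrightarrow>
     (\<forall>a b. \<chi> (a * b) = \<chi> a * \<chi> b) \<and>
     (\<forall>a. \<chi> (a + m) = \<chi> a) \<and>
     (\<forall>a. \<chi> a = 0 \<longleftrightarrow> \<not> coprime a m)"

definition dirichlet_characters :: "nat \<Rightarrow> (nat \<Rightarrow> complex) set" where
  "dirichlet_characters m = {\<chi>. dirichlet_character m \<chi>}"

definition gen_gauss_sum :: "int \<Rightarrow> (nat \<Rightarrow> complex) \<Rightarrow> nat \<Rightarrow> complex" where
  "gen_gauss_sum n \<chi> p =
     (\<Sum>a=1..p. \<chi> a * exp (2 * of_real pi * \<i> * of_int (n * int a ^ 2) / of_nat p))"

end

theory Submission
  imports Defs "HOL-Number_Theory.Number_Theory"
begin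

text \<open>
  Write \<open>\<lambda>\<close> for the Legendre symbol and \<open>W\<close> for the quadratic Gauss sum, so that \<open>W\<^sup>2 = \<lambda>(-1) p\<close>.
  Substituting \<open>a \<mapsto> a b\<close> in the double sum gives \<open>|G(n,\<chi>)|\<^sup>2 = \<Sum>\<^sub>a \<chi>(a) c(a)\<close> with
  \<open>c(a) = p [a\<^sup>2 = 1] - 1 + \<lambda>(a\<^sup>2 - 1) W\<close>, and orthogonality of characters turns the sixth moment
  into \<open>(p - 1) \<Sum>\<^bsub>abd = 1\<^esub> c(a) c(b) c(d)\<close>. Expanding, everything is explicit except
  \<open>W\<^sup>3 T\<close> with \<open>T = \<Sum>\<^bsub>a,b\<^esub> \<lambda>((a\<^sup>2 - 1)(b\<^sup>2 - 1)(1 - a\<^sup>2 b\<^sup>2))\<close>.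

  If \<open>\<lambda>(-1) = -1\<close>, inverting \<open>a\<close> and \<open>b\<close> shows \<open>T = 0\<close>. If \<open>\<lambda>(-1) = 1\<close>, one needs \<open>T = O(p)\<close>, which
  is proved without the Weil bounds: up to sums of quadratic polynomials, \<open>T\<close> is
  \<open>D = \<Sum> \<lambda>(x y (x - 1)(y - 1)(1 - x y))\<close>, and two linear substitutions identify \<open>D\<close>, up to \<open>O(p)\<close>, with
  \<open>E = \<Sum>\<^sub>k \<lambda>(k (1 - k)) \<phi>(k)\<close> where \<open>\<phi>(k) = \<Sum>\<^sub>a \<lambda>(a (a\<^sup>2 - k))\<close> is a Jacobsthal sum. Since
  \<open>\<phi>(k r\<^sup>2) = \<lambda>(r) \<phi>(k)\<close>, averaging \<open>k \<mapsto> k r\<^sup>2\<close> over \<open>r\<close> yields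
  \<open>(p - 1) E = \<Sum>\<^sub>k \<lambda>(k) \<phi>(k)\<^sup>2\<close>, and \<open>\<Sum>\<^sub>k \<phi>(k)\<^sup>2 \<le> 2 p\<^sup>2\<close> is an elementary count.
\<close>

section \<open>Sums of Legendre symbols\<close>

lemma abs_mult_le_1: "\<bar>x\<bar> \<le> 1 \<Longrightarrow> \<bar>y\<bar> \<le> 1 \<Longrightarrow> \<bar>x * y\<bar> \<le> 1" for x y :: int
  by (simp add: abs_mult mult_le_one)

locale odd_prime =
  fixes p :: nat
  assumes prime_p: "prime p" and p_gt_2: "p > 2"
begin

definition lam :: "int \<Rightarrow> int" where
  "lam x = Legendre x (int p)"

abbreviation R :: "int set" where "R \<equiv> {0..<int p}"
abbreviation U :: "int set" where "U \<equiv> {1..<int p}"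

text \<open>Functions on the residue field are encoded as integer functions constant on residue
  classes, so that substitutions need not be reduced modulo p at every step.\<close>

definition periodic :: "(int \<Rightarrow> 'a) \<Rightarrow> bool" where
  "periodic f \<longleftrightarrow> (\<forall>x y. [x = y] (mod int p) \<longrightarrow> f x = f y)"

text \<open>Fermat's exponent gives the inverse as a power of x: congruences pass through it
  directly and, as p > 2, zero goes to zero.\<close>

definition inv_mod :: "int \<Rightarrow> int" where
  "inv_mod x = x ^ (p - 2)"

lemma prime_int_p: "prime (int p)"
  using prime_p by simp

lemma periodicI: "(\<And>x y. [x = y] (mod int p) \<Longrightarrow> f x = f y) \<Longrightarrow> periodic f"
  by (simp add: periodic_def)

lemma periodicD: "periodic f \<Longrightarrow> [x = y] (mod int p) \<Longrightarrow> f x = f y"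
  by (simp add: periodic_def)

lemma periodic_mod: "periodic f \<Longrightarrow> f (x mod int p) = f x"
  by (rule periodicD) auto

lemma lam_cong: "[x = y] (mod int p) \<Longrightarrow> lam x = lam y"
  by (simp add: lam_def Legendre_def QuadRes_def cong_def)

lemma lam_eq_0_iff: "lam x = 0 \<longleftrightarrow> int p dvd x"
  by (auto simp: lam_def Legendre_def cong_0_iff)

lemma lam_0 [simp]: "lam 0 = 0"
  by (simp add: lam_eq_0_iff)

lemma lam_cases: "lam x = 0 \<or> lam x = 1 \<or> lam x = -1"
  by (auto simp: lam_def Legendre_def)

lemma abs_lam_le: "\<bar>lam x\<bar> \<le> 1"
  using lam_cases[of x] by auto

lemma lam_euler: "[lam x = x ^ ((p - 1) div 2)] (mod int p)"
  unfolding lam_def using euler_criterion[OF prime_p p_gt_2] .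

text \<open>Euler's criterion gives the congruence modulo p; the two sides differ by at most 2 < p,
  so they are equal.\<close>

lemma lam_mult: "lam (x * y) = lam x * lam y"
proof -
  have "[lam (x * y) = lam x * lam y] (mod int p)"
    using lam_euler[of "x * y"] cong_mult[OF lam_euler[of x] lam_euler[of y]]
    by (metis cong_sym cong_trans power_mult_distrib)
  hence d: "int p dvd lam (x * y) - lam x * lam y"
    by (simp add: cong_iff_dvd_diff)
  have "\<bar>lam (x * y) - lam x * lam y\<bar> \<le> 2"
    using lam_cases[of x] lam_cases[of y] lam_cases[of "x * y"] by auto
  thus ?thesis
    using d p_gt_2 zdvd_imp_le[of "int p" "\<bar>lam (x * y) - lam x * lam y\<bar>"] by (cases "lam (x * y) - lam x * lam y = 0") auto
qed

lemma lam_1 [simp]: "lam 1 = 1"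
proof -
  have "lam 1 = lam 1 * lam 1" using lam_mult[of 1 1] by simp
  moreover have "lam 1 \<noteq> 0" using p_gt_2 by (simp add: lam_eq_0_iff)
  ultimately show ?thesis by simp
qed

lemma lam_sq: "\<not> int p dvd x \<Longrightarrow> lam x * lam x = 1"
  using lam_cases[of x] by (auto simp: lam_eq_0_iff)

lemma lam_square: "\<not> int p dvd x \<Longrightarrow> lam (x\<^sup>2) = 1"
  by (simp add: power2_eq_square lam_mult lam_sq)

lemma lam_diff_commute: "lam (x - y) = lam (-1) * lam (y - x)"
  by (simp flip: lam_mult)

lemma periodic_const: "periodic (\<lambda>x. c)"
  by (simp add: periodic_def)

lemma periodic_mult: "periodic f \<Longrightarrow> periodic g \<Longrightarrow> periodic (\<lambda>x. f x * g x)"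
  unfolding periodic_def by metis

lemma periodic_add: "periodic f \<Longrightarrow> periodic g \<Longrightarrow> periodic (\<lambda>x. f x + g x)"
  unfolding periodic_def by metis

lemma periodic_lam:
  "(\<And>x y. [x = y] (mod int p) \<Longrightarrow> [h x = h y] (mod int p)) \<Longrightarrow> periodic (\<lambda>x. lam (h x))"
  unfolding periodic_def by (auto intro: lam_cong)

lemma periodic_sum: "(\<And>a. a \<in> A \<Longrightarrow> periodic (\<lambda>x. f x a)) \<Longrightarrow> periodic (\<lambda>x. \<Sum>a\<in>A. f x a)"
  unfolding periodic_def by (auto intro: sum.cong)

lemmas periodic_intros = periodic_const periodic_mult periodic_add periodic_lam periodic_sum
  cong_add cong_diff cong_mult cong_pow cong_refl cong_uminus

section \<open>Permuting the residues in a sum\<close>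

lemma finite_R: "finite R" by auto

lemma R_eq: "R = insert 0 U" using p_gt_2 by auto

lemma sum_R: "(\<Sum>x\<in>R. f x) = f 0 + (\<Sum>x\<in>U. f x)" for f :: "int \<Rightarrow> 'a::comm_monoid_add"
  unfolding R_eq by (subst sum.insert) auto

lemma U_iff: "x \<in> R \<Longrightarrow> x \<in> U \<longleftrightarrow> \<not> int p dvd x"
  using zdvd_not_zless[of x "int p"] by (cases "x = 0") auto

lemma U_not_dvd: "x \<in> U \<Longrightarrow> \<not> int p dvd x"
  using U_iff[of x] by auto

lemma R_cong_eq: "x \<in> R \<Longrightarrow> y \<in> R \<Longrightarrow> [x = y] (mod int p) \<Longrightarrow> x = y"
  by (auto simp: cong_def)

text \<open>Reduced modulo p, \<open>h\<close> is an injective self-map of the finite set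
  \<open>R\<close>, hence a permutation.\<close>

lemma sum_R_reindex:
  fixes f :: "int \<Rightarrow> 'a::comm_monoid_add"
  assumes f: "periodic f" and h: "\<And>x y. x \<in> R \<Longrightarrow> y \<in> R \<Longrightarrow> [h x = h y] (mod int p) \<Longrightarrow> [x = y] (mod int p)"
  shows "(\<Sum>x\<in>R. f (h x)) = (\<Sum>x\<in>R. f x)"
proof -
  let ?h = "\<lambda>x. h x mod int p"
  have "inj_on ?h R"
    using h R_cong_eq unfolding inj_on_def cong_def by blast
  moreover have "?h ` R \<subseteq> R" using p_gt_2 by auto
  ultimately have "bij_betw ?h R R"
    unfolding bij_betw_def using endo_inj_surj[OF finite_R] by auto
  hence "(\<Sum>x\<in>R. f (?h x)) = (\<Sum>x\<in>R. f x)" by (rule sum.reindex_bij_betw)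
  thus ?thesis by (simp add: periodic_mod[OF f])
qed

lemma cong_mult_cancel: "\<not> int p dvd a \<Longrightarrow> [a * x = a * y] (mod int p) \<Longrightarrow> [x = y] (mod int p)"
  using prime_int_p
  by (metis cong_iff_dvd_diff prime_dvd_mult_iff right_diff_distrib)

lemma sum_affine:
  fixes f :: "int \<Rightarrow> 'a::comm_monoid_add"
  assumes "periodic f" "\<not> int p dvd a"
  shows "(\<Sum>x\<in>R. f (a * x + b)) = (\<Sum>x\<in>R. f x)"
  using assms by (intro sum_R_reindex) (auto simp: cong_add_rcancel intro: cong_mult_cancel)

lemma sum_scale:
  fixes f :: "int \<Rightarrow> 'a::comm_monoid_add"
  assumes "periodic f" "\<not> int p dvd a"
  shows "(\<Sum>x\<in>R. f (a * x)) = (\<Sum>x\<in>R. f x)"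
  using sum_affine[OF assms, of 0] by simp

lemma sum_shift:
  fixes f :: "int \<Rightarrow> 'a::comm_monoid_add"
  assumes "periodic f"
  shows "(\<Sum>x\<in>R. f (x + b)) = (\<Sum>x\<in>R. f x)"
  using sum_affine[OF assms, of 1 b] p_gt_2 by simp

lemma sum_scale_U:
  fixes f :: "int \<Rightarrow> 'a::ab_group_add"
  assumes "periodic f" "\<not> int p dvd a"
  shows "(\<Sum>x\<in>U. f (a * x)) = (\<Sum>x\<in>U. f x)"
  using sum_scale[OF assms] by (simp add: sum_R)

section \<open>Inverses modulo p\<close>

lemma inv_mod: "\<not> int p dvd x \<Longrightarrow> [x * inv_mod x = 1] (mod int p)"
proof -
  assume x: "\<not> int p dvd x"
  have "x mod int p \<ge> 0" "x mod int p \<noteq> 0" "x mod int p < int p"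
    using x p_gt_2 by (auto simp: dvd_eq_mod_eq_0)
  hence "\<not> p dvd nat (x mod int p)"
    by (intro nat_dvd_not_less) auto
  hence "[nat (x mod int p) ^ (p - 1) = 1] (mod p)"
    by (intro fermat_theorem prime_p)
  hence "[int (nat (x mod int p)) ^ (p - 1) = 1] (mod int p)"
    by (metis cong_int_iff of_nat_1 of_nat_power)
  hence "[(x mod int p) ^ (p - 1) = 1] (mod int p)"
    using p_gt_2 by simp
  hence "[x ^ (p - 1) = 1] (mod int p)" by (simp add: cong_def power_mod)
  moreover have "x ^ (p - 1) = x * inv_mod x"
  proof -
    have "p - 1 = Suc (p - 2)" using p_gt_2 by simp
    thus ?thesis by (simp add: inv_mod_def)
  qed
  ultimately show ?thesis by simp
qed

lemma inv_mod_not_dvd: "\<not> int p dvd x \<Longrightarrow> \<not> int p dvd inv_mod x"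
  using prime_int_p by (metis inv_mod_def prime_dvd_power)

lemma inv_mod_cong: "[x = y] (mod int p) \<Longrightarrow> [inv_mod x = inv_mod y] (mod int p)"
  by (simp add: inv_mod_def cong_pow)

lemma sum_inv:
  fixes f :: "int \<Rightarrow> 'a::ab_group_add"
  assumes "periodic f"
  shows "(\<Sum>x\<in>U. f (inv_mod x)) = (\<Sum>x\<in>U. f x)"
proof -
  have 0: "inv_mod 0 = 0" using p_gt_2 by (simp add: inv_mod_def)
  have "(\<Sum>x\<in>R. f (inv_mod x)) = (\<Sum>x\<in>R. f x)"
  proof (rule sum_R_reindex[OF assms])
    fix x y assume xy: "x \<in> R" "y \<in> R" and c: "[inv_mod x = inv_mod y] (mod int p)"
    show "[x = y] (mod int p)"
    proof (cases "int p dvd x \<or> int p dvd y")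
      \<comment> \<open>Inversion fixes zero and preserves units, so either both arguments vanish or
        neither does.\<close>
      case True
      hence "int p dvd x \<and> int p dvd y"
        using c 0 inv_mod_not_dvd inv_mod_cong
        by (metis cong_0_iff cong_sym cong_trans)
      thus ?thesis by (simp add: cong_iff_dvd_diff)
    next
      case False
      \<comment> \<open>For units, equal inverses give y = y x (1/x) = x y (1/y) = x.\<close>
      have "[y * (x * inv_mod x) = y * 1] (mod int p)"
        using False by (intro cong_mult inv_mod) auto
      moreover have "[x * (y * inv_mod y) = x * 1] (mod int p)"
        using False by (intro cong_mult inv_mod) auto
      moreover have "[y * (x * inv_mod x) = x * (y * inv_mod y)] (mod int p)"
        using c by (simp add: mult.left_commute cong_scalar_left)
      ultimately show ?thesis by (metis cong_sym cong_trans mult.right_neutral)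
    qed
  qed
  thus ?thesis by (simp add: sum_R 0)
qed

lemma lam_inv: "\<not> int p dvd x \<Longrightarrow> lam (inv_mod x) = lam x"
proof -
  assume x: "\<not> int p dvd x"
  have "lam x * lam (inv_mod x) = 1"
    using lam_cong[OF inv_mod[OF x]] by (simp add: lam_mult)
  thus ?thesis using lam_cases[of x] by auto
qed

section \<open>Square roots, and sums of linear and quadratic symbols\<close>

lemma dvd_square_diff: "int p dvd x\<^sup>2 - y\<^sup>2 \<longleftrightarrow> int p dvd x - y \<or> int p dvd x + y"
  by (simp add: prime_dvd_mult_iff[OF prime_int_p] power2_eq_square square_diff_square_factored disj_commute)

text \<open>Zero has the single root 0, a nonzero square has the roots b and -b, distinct because p
  is odd, and a non-residue has none.\<close>

lemma card_square_roots: "x \<in> R \<Longrightarrow> int (card {a\<in>R. [a\<^sup>2 = x] (mod int p)}) = 1 + lam x"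
proof -
  assume x: "x \<in> R"
  have dbl: "int p dvd 2 * a \<longleftrightarrow> int p dvd a" for a
    using prime_dvd_mult_iff[OF prime_int_p] p_gt_2 by (auto dest: zdvd_imp_le)
  consider "x = 0" | "x \<noteq> 0" "\<exists>b. [b\<^sup>2 = x] (mod int p)" | "x \<noteq> 0" "\<not> (\<exists>b. [b\<^sup>2 = x] (mod int p))" by blast
  thus ?thesis
  proof cases
    case 1
    have "a = 0" if "a \<in> R" "[a\<^sup>2 = 0] (mod int p)" for a
      using that prime_dvd_power[OF prime_int_p, of a 2] U_iff[of a] by (auto simp: cong_0_iff)
    hence "{a\<in>R. [a\<^sup>2 = x] (mod int p)} = {0}" using 1 p_gt_2 by auto
    thus ?thesis using 1 by simp
  next
    case 2
    then obtain b where b: "[b\<^sup>2 = x] (mod int p)" by blast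
    have nd: "\<not> int p dvd x" using x 2 U_iff[of x] by auto
    have ndb: "\<not> int p dvd b"
      using b nd by (metis cong_dvd_iff dvd_power_same dvd_trans dvd_power zero_less_numeral)
    have l: "lam x = 1" using b lam_cong lam_square[OF ndb] by metis
    have eq: "{a\<in>R. [a\<^sup>2 = x] (mod int p)} = {b mod int p, (-b) mod int p}"
    proof (intro equalityI subsetI)
      fix a assume a: "a \<in> {a\<in>R. [a\<^sup>2 = x] (mod int p)}"
      hence "[a\<^sup>2 = b\<^sup>2] (mod int p)" using b cong_sym cong_trans by blast
      hence "int p dvd a - b \<or> int p dvd a + b" by (simp add: cong_iff_dvd_diff dvd_square_diff)
      hence "[a = b] (mod int p) \<or> [a = -b] (mod int p)" by (auto simp: cong_iff_dvd_diff)
      thus "a \<in> {b mod int p, (-b) mod int p}" using a by (auto simp: cong_def)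
    next
      fix a assume "a \<in> {b mod int p, (-b) mod int p}"
      hence aR: "a \<in> R" and "[a = b] (mod int p) \<or> [a = -b] (mod int p)" using p_gt_2 by auto
      hence "[a\<^sup>2 = b\<^sup>2] (mod int p)" by (metis cong_pow power2_minus)
      thus "a \<in> {a\<in>R. [a\<^sup>2 = x] (mod int p)}" using aR b cong_trans by blast
    qed
    have "\<not> [b = - b] (mod int p)"
      using ndb dbl[of b] by (simp add: cong_iff_dvd_diff)
    hence "b mod int p \<noteq> (-b) mod int p" by (simp add: cong_def)
    thus ?thesis unfolding eq using l by simp
  next
    case 3
    hence "lam x = -1" using x U_iff[of x] by (auto simp: lam_def Legendre_def QuadRes_def cong_0_iff)
    moreover have "{a\<in>R. [a\<^sup>2 = x] (mod int p)} = {}" using 3 by auto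
    ultimately show ?thesis by (simp only: card.empty)
  qed
qed

text \<open>Grouping the arguments by the value of their square trades squares for the weight
  \<open>1 + lam x\<close>, the number of square roots of x. This is how squared variables are
  removed later.\<close>

lemma sum_squares:
  fixes f :: "int \<Rightarrow> 'a::comm_ring_1"
  assumes f: "periodic f"
  shows "(\<Sum>a\<in>R. f (a\<^sup>2)) = (\<Sum>x\<in>R. (1 + of_int (lam x)) * f x)"
proof -
  have "(\<Sum>a\<in>R. f (a\<^sup>2)) = (\<Sum>x\<in>R. \<Sum>a\<in>{a\<in>R. a\<^sup>2 mod int p = x}. f (a\<^sup>2))"
    using p_gt_2 by (intro sum.group[symmetric]) auto
  also have "\<dots> = (\<Sum>x\<in>R. (1 + of_int (lam x)) * f x)"
  proof (rule sum.cong[OF refl])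
    fix x assume x: "x \<in> R"
    have eq: "{a\<in>R. a\<^sup>2 mod int p = x} = {a\<in>R. [a\<^sup>2 = x] (mod int p)}"
      using x by (auto simp: cong_def)
    have "(\<Sum>a\<in>{a\<in>R. a\<^sup>2 mod int p = x}. f (a\<^sup>2)) = (\<Sum>a\<in>{a\<in>R. [a\<^sup>2 = x] (mod int p)}. f x)"
      unfolding eq by (intro sum.cong refl periodicD[OF f]) auto
    also have "\<dots> = of_int (int (card {a\<in>R. [a\<^sup>2 = x] (mod int p)})) * f x" by simp
    finally show "(\<Sum>a\<in>{a\<in>R. a\<^sup>2 mod int p = x}. f (a\<^sup>2)) = (1 + of_int (lam x)) * f x"
      by (simp only: card_square_roots[OF x] of_int_add of_int_1)
  qed
  finally show ?thesis .
qed

lemma sum_squares_U: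
  fixes f :: "int \<Rightarrow> 'a::comm_ring_1"
  assumes f: "periodic f"
  shows "(\<Sum>a\<in>U. f (a\<^sup>2)) = (\<Sum>x\<in>U. (1 + of_int (lam x)) * f x)"
  using sum_squares[OF f] by (simp add: sum_R)

text \<open>The constant function 1 in \<open>sum_squares\<close> gives p = p + (the sum of
  \<open>lam\<close>).\<close>

lemma sum_lam: "(\<Sum>x\<in>R. lam x) = 0"
proof -
  have "(\<Sum>a\<in>R. 1::int) = (\<Sum>x\<in>R. (1 + lam x) * 1)"
    using sum_squares[OF periodic_const[of "1::int"]] by simp
  thus ?thesis by (simp add: sum.distrib)
qed

lemma sum_lam_affine: "\<not> int p dvd a \<Longrightarrow> (\<Sum>x\<in>R. lam (a * x + b)) = 0"
  using sum_affine[of lam a b] sum_lam by (simp add: periodic_def lam_cong)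

text \<open>For a unit y, \<open>lam y\<close> equals \<open>lam (inv_mod y)\<close>, so the product
  is \<open>lam (c * inv_mod y + 1)\<close>. Inverting y leaves a complete linear sum, which is 0,
  without its term \<open>lam 1\<close> at y = 0.\<close>

lemma sum_lam_consecutive:
  assumes "\<not> int p dvd c"
  shows "(\<Sum>y\<in>R. lam y * lam (y + c)) = -1"
proof -
  have "(\<Sum>y\<in>R. lam y * lam (y + c)) = (\<Sum>y\<in>U. lam y * lam (y + c))"
    by (simp add: sum_R)
  also have "\<dots> = (\<Sum>y\<in>U. lam (c * inv_mod y + 1))"
  proof (rule sum.cong[OF refl])
    fix y assume y: "y \<in> U"
    have "lam y * lam (y + c) = lam (inv_mod y * (y + c))"
      using lam_inv[OF U_not_dvd[OF y]] by (simp add: lam_mult)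
    also have "[inv_mod y * (y + c) = c * inv_mod y + 1] (mod int p)"
      using cong_add[OF cong_refl[of "c * inv_mod y"] inv_mod[OF U_not_dvd[OF y]]]
      by (simp add: algebra_simps)
    hence "lam (inv_mod y * (y + c)) = lam (c * inv_mod y + 1)" by (rule lam_cong)
    finally show "lam y * lam (y + c) = lam (c * inv_mod y + 1)" .
  qed
  also have "\<dots> = (\<Sum>y\<in>U. lam (c * y + 1))"
    by (rule sum_inv) (intro periodic_intros)
  also have "\<dots> = -1"
    using sum_lam_affine[OF assms, of 1] by (simp add: sum_R)
  finally show ?thesis .
qed

text \<open>Shifting y by a places the roots at 0 and b - a; if they coincide, each of the p - 1
  nonzero y contributes 1.\<close>

lemma sum_lam_quadratic:
  "(\<Sum>y\<in>R. lam (y - a) * lam (y - b)) = (if [a = b] (mod int p) then int p - 1 else -1)"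
proof -
  have "(\<Sum>y\<in>R. lam (y - a) * lam (y - b)) = (\<Sum>y\<in>R. lam (y + a - a) * lam (y + a - b))"
    by (rule sum_shift[symmetric]) (intro periodic_intros)
  also have "\<dots> = (\<Sum>y\<in>R. lam y * lam (y + (a - b)))" by (simp add: add_diff_eq)
  also have "\<dots> = (if [a = b] (mod int p) then int p - 1 else -1)"
  proof (cases "[a = b] (mod int p)")
    case True
    have "(\<Sum>y\<in>R. lam y * lam (y + (a - b))) = (\<Sum>y\<in>R. lam y * lam y)"
    proof (intro sum.cong refl arg_cong2[of _ _ _ _ "(*)"] lam_cong)
      fix y show "[y + (a - b) = y] (mod int p)" using True by (simp add: cong_iff_dvd_diff)
    qed
    also have "\<dots> = (\<Sum>y\<in>U. 1)" by (simp add: sum_R lam_sq U_not_dvd)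
    finally show ?thesis using True p_gt_2 by simp
  next
    case False
    thus ?thesis using sum_lam_consecutive[of "a - b"] by (simp add: cong_iff_dvd_diff)
  qed
  finally show ?thesis .
qed

end

section \<open>The triple sum of Legendre symbols\<close>

context odd_prime begin

section \<open>Jacobsthal sums and their mean square\<close>

definition phi :: "int \<Rightarrow> int" where
  "phi k = (\<Sum>a\<in>R. lam a * lam (a\<^sup>2 - k))"

lemma phi_cong: "[k = l] (mod int p) \<Longrightarrow> phi k = phi l"
  unfolding phi_def by (intro sum.cong refl arg_cong2[of _ _ _ _ "(*)"] lam_cong cong_diff) auto

lemma periodic_phi: "periodic phi"
  by (rule periodicI) (rule phi_cong)

text \<open>Substituting r a for a pulls r^3 out of a (a^2 - k r^2), and \<open>lam\<close> of r^3
  is \<open>lam r\<close>.\<close>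

lemma phi_scale:
  assumes r: "\<not> int p dvd r"
  shows "phi (k * r\<^sup>2) = lam r * phi k"
proof -
  have "phi (k * r\<^sup>2) = (\<Sum>a\<in>R. lam (r * a) * lam ((r * a)\<^sup>2 - k * r\<^sup>2))"
    unfolding phi_def by (rule sum_scale[symmetric, OF _ r]) (intro periodic_intros)
  also have "\<dots> = (\<Sum>a\<in>R. lam r * (lam a * lam (a\<^sup>2 - k)))"
  proof (rule sum.cong[OF refl])
    fix a
    have "(r * a)\<^sup>2 - k * r\<^sup>2 = r\<^sup>2 * (a\<^sup>2 - k)" by (simp add: algebra_simps)
    thus "lam (r * a) * lam ((r * a)\<^sup>2 - k * r\<^sup>2) = lam r * (lam a * lam (a\<^sup>2 - k))"
      by (simp add: lam_mult lam_square[OF r])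
  qed
  finally show ?thesis by (simp add: phi_def sum_distrib_left)
qed

text \<open>Inverting r turns 1 - k r^2 into (r^2 - k) / r^2, and the square denominator does not
  affect \<open>lam\<close>. In the average of E over r this supplies the second factor
  \<open>phi k\<close>.\<close>

lemma phi_recip: "(\<Sum>r\<in>U. lam r * lam (1 - k * r\<^sup>2)) = phi k"
proof -
  have "(\<Sum>r\<in>U. lam r * lam (1 - k * r\<^sup>2)) = (\<Sum>r\<in>U. lam (inv_mod r) * lam (1 - k * (inv_mod r)\<^sup>2))"
    by (rule sum_inv[symmetric]) (intro periodic_intros)
  also have "\<dots> = (\<Sum>r\<in>U. lam r * lam (r\<^sup>2 - k))"
  proof (rule sum.cong[OF refl])
    fix r assume "r \<in> U"
    hence r: "\<not> int p dvd r" by (rule U_not_dvd)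
    have "[(r * inv_mod r)\<^sup>2 = 1\<^sup>2] (mod int p)" by (rule cong_pow[OF inv_mod[OF r]])
    hence "[r\<^sup>2 - k * (r * inv_mod r)\<^sup>2 = r\<^sup>2 - k * 1\<^sup>2] (mod int p)" by (intro cong_diff cong_mult cong_refl)
    hence "lam (r\<^sup>2 * (1 - k * (inv_mod r)\<^sup>2)) = lam (r\<^sup>2 - k)"
      by (intro lam_cong) (simp add: algebra_simps)
    thus "lam (inv_mod r) * lam (1 - k * (inv_mod r)\<^sup>2) = lam r * lam (r\<^sup>2 - k)"
      by (simp add: lam_mult lam_square[OF r] lam_inv[OF r])
  qed
  finally show ?thesis by (simp add: phi_def sum_R)
qed

text \<open>The solutions lie on the two graphs b = a and b = -a, of p points each.\<close>

lemma card_equal_squares: "card {(a, b). a \<in> R \<and> b \<in> R \<and> [a\<^sup>2 = b\<^sup>2] (mod int p)} \<le> 2 * p"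
proof -
  have "{(a, b). a \<in> R \<and> b \<in> R \<and> [a\<^sup>2 = b\<^sup>2] (mod int p)}
      \<subseteq> (\<lambda>a. (a, a)) ` R \<union> (\<lambda>a. (a, (- a) mod int p)) ` R"
  proof (clarify)
    fix a b assume ab: "a \<in> R" "b \<in> R" "[a\<^sup>2 = b\<^sup>2] (mod int p)" "(a, b) \<notin> (\<lambda>a. (a, (- a) mod int p)) ` R"
    hence "int p dvd a - b \<or> int p dvd a + b" by (simp add: cong_iff_dvd_diff dvd_square_diff)
    hence "[b = a] (mod int p) \<or> [b = -a] (mod int p)"
      by (auto simp: cong_iff_dvd_diff dvd_diff_commute add.commute)
    moreover have "\<not> [b = -a] (mod int p)"
      using ab by (auto simp: cong_def image_iff)
    ultimately have "b = a" using ab by (metis R_cong_eq)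
    thus "(a, b) \<in> (\<lambda>a. (a, a)) ` R" using ab by auto
  qed
  hence "card {(a, b). a \<in> R \<and> b \<in> R \<and> [a\<^sup>2 = b\<^sup>2] (mod int p)}
      \<le> card ((\<lambda>a. (a, a)) ` R \<union> (\<lambda>a. (a, (- a) mod int p)) ` R)"
    by (intro card_mono) auto
  also have "\<dots> \<le> card ((\<lambda>a. (a, a)) ` R) + card ((\<lambda>a. (a, (- a) mod int p)) ` R)"
    by (rule card_Un_le)
  also have "\<dots> \<le> card R + card R"
    by (intro add_mono card_image_le) auto
  finally show ?thesis by simp
qed

text \<open>Expand the square and sum over k first: the quadratic sum is p - 1 when a^2 = b^2 and -1
  otherwise. The -1 present in every term factors into a product of two vanishing sums of
  \<open>lam\<close>, and at most 2p pairs remain.\<close>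

lemma sum_phi_square_le: "(\<Sum>k\<in>R. (phi k)\<^sup>2) \<le> 2 * int p ^ 2"
proof -
  have "(\<Sum>k\<in>R. (phi k)\<^sup>2)
      = (\<Sum>k\<in>R. \<Sum>a\<in>R. \<Sum>b\<in>R. (lam a * lam b) * (lam (k - a\<^sup>2) * lam (k - b\<^sup>2)))"
  proof (rule sum.cong[OF refl])
    fix k
    have m: "lam (a\<^sup>2 - k) * lam (b\<^sup>2 - k) = lam (k - a\<^sup>2) * lam (k - b\<^sup>2)" for a b
      by (simp flip: lam_mult add: algebra_simps)
    show "(phi k)\<^sup>2 = (\<Sum>a\<in>R. \<Sum>b\<in>R. (lam a * lam b) * (lam (k - a\<^sup>2) * lam (k - b\<^sup>2)))"
      unfolding phi_def power2_eq_square[of "sum _ _"] sum_product m[symmetric]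
      by (intro sum.cong refl) (simp add: mult_ac)
  qed
  also have "\<dots> = (\<Sum>a\<in>R. \<Sum>b\<in>R. \<Sum>k\<in>R. (lam a * lam b) * (lam (k - a\<^sup>2) * lam (k - b\<^sup>2)))"
    by (subst sum.swap, rule sum.cong[OF refl], subst sum.swap, rule refl)
  also have "\<dots> = (\<Sum>a\<in>R. \<Sum>b\<in>R. (lam a * lam b) * ((if [a\<^sup>2 = b\<^sup>2] (mod int p) then int p else 0) - 1))"
    by (intro sum.cong refl, subst sum_distrib_left[symmetric], subst sum_lam_quadratic) auto
  also have "\<dots> = (\<Sum>a\<in>R. \<Sum>b\<in>R. if [a\<^sup>2 = b\<^sup>2] (mod int p) then lam a * lam b * int p else 0)
                  - (\<Sum>a\<in>R. lam a) * (\<Sum>b\<in>R. lam b)"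
    unfolding sum_product sum_subtractf[symmetric]
    by (intro sum.cong refl) (auto simp: algebra_simps)
  also have "\<dots> \<le> (\<Sum>a\<in>R. \<Sum>b\<in>R. if [a\<^sup>2 = b\<^sup>2] (mod int p) then int p else 0)"
  proof -
    have "lam a * lam b * int p \<le> int p" for a b
      using lam_cases[of a] lam_cases[of b] by auto
    thus ?thesis by (simp add: sum_lam) (intro sum_mono, auto)
  qed
  also have "\<dots> = int p * int (card {(a, b). a \<in> R \<and> b \<in> R \<and> [a\<^sup>2 = b\<^sup>2] (mod int p)})"
  proof -
    have "(\<Sum>a\<in>R. \<Sum>b\<in>R. if [a\<^sup>2 = b\<^sup>2] (mod int p) then int p else 0)
        = (\<Sum>(a, b)\<in>R \<times> R. if [a\<^sup>2 = b\<^sup>2] (mod int p) then int p else 0)"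
      by (simp add: sum.cartesian_product)
    also have "\<dots> = (\<Sum>(a, b)\<in>{(a, b). a \<in> R \<and> b \<in> R \<and> [a\<^sup>2 = b\<^sup>2] (mod int p)}. int p)"
      by (rule sum.mono_neutral_cong_right) (auto split: if_splits)
    finally show ?thesis by (simp add: case_prod_unfold)
  qed
  also have "\<dots> \<le> int p * (2 * int p)"
    using card_equal_squares by (intro mult_left_mono) linarith+
  finally show ?thesis by (simp add: power2_eq_square)
qed

definition E_sum :: int where
  "E_sum = (\<Sum>k\<in>R. lam k * lam (1 - k) * phi k)"

text \<open>For each unit r, replacing k by k r^2 gives \<open>E_sum\<close> again. Summing over the
  p - 1 values of r collects the factors depending on r into \<open>phi k\<close> by
  \<open>phi_recip\<close>.\<close>

lemma E_sum_eq: "(int p - 1) * E_sum = (\<Sum>k\<in>R. lam k * (phi k)\<^sup>2)"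
proof -
  have "E_sum = (\<Sum>k\<in>R. lam k * phi k * (lam r * lam (1 - k * r\<^sup>2)))" if "r \<in> U" for r
  proof -
    have r: "\<not> int p dvd r" using that by (rule U_not_dvd)
    hence r2: "\<not> int p dvd r\<^sup>2" using prime_dvd_power[OF prime_int_p] by blast
    have "E_sum = (\<Sum>k\<in>R. lam (r\<^sup>2 * k) * lam (1 - r\<^sup>2 * k) * phi (r\<^sup>2 * k))"
      unfolding E_sum_def by (rule sum_scale[symmetric, OF _ r2]) (intro periodic_intros periodic_phi)
    also have "\<dots> = (\<Sum>k\<in>R. lam k * phi k * (lam r * lam (1 - k * r\<^sup>2)))"
      by (intro sum.cong refl) (simp add: mult.commute[of "r\<^sup>2"] phi_scale[OF r] lam_mult lam_square[OF r])
    finally show ?thesis .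
  qed
  hence "(\<Sum>r\<in>U. E_sum) = (\<Sum>r\<in>U. \<Sum>k\<in>R. lam k * phi k * (lam r * lam (1 - k * r\<^sup>2)))"
    by (intro sum.cong refl)
  also have "\<dots> = (\<Sum>k\<in>R. lam k * phi k * (\<Sum>r\<in>U. lam r * lam (1 - k * r\<^sup>2)))"
    by (subst sum.swap) (simp only: sum_distrib_left)
  also have "\<dots> = (\<Sum>k\<in>R. lam k * (phi k)\<^sup>2)"
    by (simp only: phi_recip) (simp add: power2_eq_square mult.assoc)
  finally show ?thesis using p_gt_2 by simp
qed

lemma E_sum_bound: "\<bar>E_sum\<bar> \<le> 4 * int p"
proof -
  have "(int p - 1) * \<bar>E_sum\<bar> = \<bar>\<Sum>k\<in>R. lam k * (phi k)\<^sup>2\<bar>"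
    using p_gt_2 by (simp flip: E_sum_eq add: abs_mult)
  also have "\<dots> \<le> (\<Sum>k\<in>R. \<bar>lam k * (phi k)\<^sup>2\<bar>)" by (rule sum_abs)
  also have "\<dots> \<le> (\<Sum>k\<in>R. (phi k)\<^sup>2)"
    by (rule sum_mono) (use abs_lam_le in \<open>auto simp: abs_mult mult_left_le_one_le\<close>)
  also have "\<dots> \<le> 2 * int p ^ 2" by (rule sum_phi_square_le)
  \<comment> \<open>Uses p \<le> 2 (p - 1), so that cancelling p - 1 costs a factor 2.\<close>
  also have "\<dots> \<le> (int p - 1) * (4 * int p)"
    using p_gt_2 by (simp add: power2_eq_square algebra_simps)
  finally show ?thesis using p_gt_2 by simp
qed

section \<open>Comparison of D with E\<close>

definition D_sum :: int where
  "D_sum = (\<Sum>y\<in>R. \<Sum>x\<in>R. lam x * lam y * lam (x - 1) * lam (y - 1) * lam (1 - x * y))"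

text \<open>The substitution is \<open>x = a (y - 1) / y\<close> for fixed \<open>y\<close>.\<close>
lemma D_sum_eq1:
  "D_sum = (\<Sum>y\<in>R. \<Sum>a\<in>R. lam a * lam y * lam (a * (y - 1) - y) * lam (1 - a * (y - 1)))"
  unfolding D_sum_def
proof (rule sum.cong[OF refl])
  fix y assume yR: "y \<in> R"
  consider "y = 0" | "y = 1" | "\<not> int p dvd y" "\<not> int p dvd y - 1"
  proof -
    have "y = 0 \<or> \<not> int p dvd y" using U_iff[OF yR] yR by auto
    moreover have "y = 0 \<or> y = 1 \<or> \<not> int p dvd y - 1"
      using yR zdvd_not_zless[of "y - 1" "int p"] by auto
    ultimately show ?thesis using that by blast
  qed
  thus "(\<Sum>x\<in>R. lam x * lam y * lam (x - 1) * lam (y - 1) * lam (1 - x * y))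
      = (\<Sum>a\<in>R. lam a * lam y * lam (a * (y - 1) - y) * lam (1 - a * (y - 1)))"
  proof cases
    case 1
    thus ?thesis by simp
  next
    case 2
    \<comment> \<open>At y = 1 the left side has the factor \<open>lam 0\<close>, and the right side
      is a multiple of the complete sum of \<open>lam a\<close>.\<close>
    thus ?thesis by (simp add: sum_lam flip: sum_distrib_right)
  next
    case 3
    define m where "m = (y - 1) * inv_mod y"
    have m: "\<not> int p dvd m" "lam m = lam (y - 1) * lam y"
      using 3 prime_dvd_mult_iff[OF prime_int_p] inv_mod_not_dvd by (auto simp: m_def lam_mult lam_inv)
    have ym: "[y * m = y - 1] (mod int p)"
      using cong_mult[OF cong_refl[of "y - 1"] inv_mod[OF 3(1)]] by (simp add: m_def mult_ac)
    have "(\<Sum>x\<in>R. lam x * lam y * lam (x - 1) * lam (y - 1) * lam (1 - x * y))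
        = (\<Sum>x\<in>R. lam (m * x) * lam y * lam (m * x - 1) * lam (y - 1) * lam (1 - m * x * y))"
      by (rule sum_scale[symmetric, OF _ m(1)]) (intro periodic_intros)
    also have "\<dots> = (\<Sum>a\<in>R. lam a * lam y * lam (a * (y - 1) - y) * lam (1 - a * (y - 1)))"
    proof (rule sum.cong[OF refl])
      fix a
      have c: "[a * (y * m) = a * (y - 1)] (mod int p)" using ym by (rule cong_scalar_left)
      have "[1 - m * a * y = 1 - a * (y - 1)] (mod int p)"
        using cong_diff[OF cong_refl[of 1] c] by (simp add: mult_ac)
      hence 1: "lam (1 - m * a * y) = lam (1 - a * (y - 1))" by (rule lam_cong)
      have "[y * (m * a - 1) = a * (y - 1) - y] (mod int p)"
        using cong_diff[OF c cong_refl[of y]] by (simp add: algebra_simps)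
      hence 2: "lam y * lam (m * a - 1) = lam (a * (y - 1) - y)"
        by (metis lam_cong lam_mult)
      have "lam (m * a) * lam y * lam (m * a - 1) * lam (y - 1) * lam (1 - m * a * y)
          = lam a * lam y * (lam y * lam (m * a - 1)) * lam (1 - m * a * y) * (lam (y - 1) * lam (y - 1))"
        by (simp add: lam_mult m(2) mult_ac)
      thus "lam (m * a) * lam y * lam (m * a - 1) * lam (y - 1) * lam (1 - m * a * y)
          = lam a * lam y * lam (a * (y - 1) - y) * lam (1 - a * (y - 1))"
        by (simp only: 1 2 lam_sq[OF 3(2)] mult.right_neutral)
    qed
    finally show ?thesis .
  qed
qed

text \<open>The substitution is \<open>y = (a\<^sup>2 - k) / (a (a - 1))\<close> for fixed \<open>a\<close>: it moves the roots of the
  cubic in \<open>y\<close> to \<open>0\<close>, \<open>1\<close>, \<open>a\<^sup>2\<close>.\<close>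
lemma D_inner_eq:
  assumes a: "\<not> int p dvd a" "\<not> int p dvd a - 1"
  shows "(\<Sum>y\<in>R. lam a * lam y * lam (a * (y - 1) - y) * lam (1 - a * (y - 1)))
       = (\<Sum>k\<in>R. lam k * lam (1 - k) * (lam a * lam (a\<^sup>2 - k)))"
proof -
  define c where "c = a * (a - 1)"
  have c: "\<not> int p dvd c" using a prime_dvd_mult_iff[OF prime_int_p] by (simp add: c_def)
  have lc: "lam c = lam a * lam (a - 1)" by (simp add: c_def lam_mult)
  define F where "F = (\<lambda>z. lam a * lam z * lam (z - a\<^sup>2) * lam (a\<^sup>2 - 1 - z))"
  have "(\<Sum>y\<in>R. lam a * lam y * lam (a * (y - 1) - y) * lam (1 - a * (y - 1))) = (\<Sum>y\<in>R. F (c * y))"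
  proof (rule sum.cong[OF refl])
    fix y
    have "c * y - a\<^sup>2 = a * (a * (y - 1) - y)" "a\<^sup>2 - 1 - c * y = (a - 1) * (1 - a * (y - 1))"
      by (simp_all add: c_def algebra_simps power2_eq_square)
    hence "F (c * y) = lam a * lam y * lam (a * (y - 1) - y) * lam (1 - a * (y - 1))
              * (lam a * lam a) * (lam (a - 1) * lam (a - 1))"
      unfolding F_def by (simp add: lam_mult lc mult_ac)
    thus "lam a * lam y * lam (a * (y - 1) - y) * lam (1 - a * (y - 1)) = F (c * y)"
      by (simp add: lam_sq a)
  qed
  also have "\<dots> = (\<Sum>z\<in>R. F z)"
    by (rule sum_scale[OF _ c]) (unfold F_def, intro periodic_intros)
  also have "\<dots> = (\<Sum>k\<in>R. F ((-1) * k + a\<^sup>2))"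
    by (rule sum_affine[symmetric]) (use p_gt_2 in \<open>auto simp: F_def intro!: periodic_intros\<close>)
  also have "\<dots> = (\<Sum>k\<in>R. lam k * lam (1 - k) * (lam a * lam (a\<^sup>2 - k)))"
  proof (rule sum.cong[OF refl])
    fix k
    have "F ((-1) * k + a\<^sup>2) = lam a * lam (a\<^sup>2 - k) * (lam (- k) * lam (k - 1))"
      by (simp add: F_def mult_ac)
    also have "lam (- k) * lam (k - 1) = lam k * lam (1 - k)"
      by (simp flip: lam_mult add: algebra_simps)
    finally show "F ((-1) * k + a\<^sup>2) = lam k * lam (1 - k) * (lam a * lam (a\<^sup>2 - k))" by simp
  qed
  finally show ?thesis .
qed

lemma abs_sum_le_p: "(\<And>x. x \<in> R \<Longrightarrow> \<bar>f x\<bar> \<le> c) \<Longrightarrow> \<bar>\<Sum>x\<in>R. f x\<bar> \<le> c * int p" for f :: "int \<Rightarrow> int"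
  using order_trans[OF sum_abs sum_bounded_above[of R "\<lambda>x. \<bar>f x\<bar>" c]] by (simp add: mult.commute)

text \<open>After the substitutions D and E are sums over a whose terms agree outside a = 1, where
  \<open>D_inner_eq\<close> does not apply. The two terms there are at most p in absolute value,
  giving 4p + p + p.\<close>

lemma D_sum_bound: "\<bar>D_sum\<bar> \<le> 6 * int p"
proof -
  define S where "S = (\<lambda>a. \<Sum>y\<in>R. lam a * lam y * lam (a * (y - 1) - y) * lam (1 - a * (y - 1)))"
  define T where "T = (\<lambda>a. \<Sum>k\<in>R. lam k * lam (1 - k) * (lam a * lam (a\<^sup>2 - k)))"
  have D: "D_sum = (\<Sum>a\<in>R. S a)" unfolding D_sum_eq1 S_def by (rule sum.swap)
  have E: "E_sum = (\<Sum>a\<in>R. T a)"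
    unfolding E_sum_def phi_def T_def sum_distrib_left by (rule sum.swap)
  have "S a - T a = (if a = 1 then S 1 - T 1 else 0)" if a: "a \<in> R" for a
  proof -
    consider "a = 0" | "a = 1" | "a \<noteq> 1" "\<not> int p dvd a" "\<not> int p dvd a - 1"
      using U_iff[OF a] a zdvd_not_zless[of "a - 1" "int p"] by force
    \<comment> \<open>At a = 0 both terms vanish through the factor \<open>lam a\<close>.\<close>
    thus ?thesis using D_inner_eq by cases (auto simp: S_def T_def)
  qed
  hence "(\<Sum>a\<in>R. S a - T a) = (\<Sum>a\<in>R. if a = 1 then S 1 - T 1 else 0)" by (intro sum.cong refl)
  hence "D_sum - E_sum = S 1 - T 1" using p_gt_2 by (simp add: D E sum_subtractf)
  moreover have "\<bar>S 1\<bar> \<le> 1 * int p" "\<bar>T 1\<bar> \<le> 1 * int p"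
    unfolding S_def T_def by (intro abs_sum_le_p abs_mult_le_1 abs_lam_le)+
  ultimately show ?thesis using E_sum_bound by linarith
qed

section \<open>From D to T\<close>

definition inner :: "int \<Rightarrow> int" where
  "inner x = (\<Sum>y\<in>U. lam (y - 1) * lam (1 - x * y))"

text \<open>With y = 0 restored this is, up to sign, a quadratic sum with the roots 1 and 1/x,
  distinct since x is not 1, so it has absolute value 1. The removed term is
  \<open>lam (-1)\<close>.\<close>

lemma inner_bound:
  assumes "\<not> int p dvd x" "\<not> int p dvd x - 1"
  shows "\<bar>inner x\<bar> \<le> 2"
proof -
  have "lam (1 - x * y) = lam (- x) * lam (y - inv_mod x)" for y
    unfolding lam_mult[symmetric]
  proof (rule lam_cong)
    show "[1 - x * y = - x * (y - inv_mod x)] (mod int p)"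
      using cong_diff[OF inv_mod[OF assms(1)] cong_refl[of "x * y"]]
      by (simp add: algebra_simps cong_sym)
  qed
  hence "(\<Sum>y\<in>R. lam (y - 1) * lam (1 - x * y)) = lam (-x) * (\<Sum>y\<in>R. lam (y - 1) * lam (y - inv_mod x))"
    by (simp add: sum_distrib_left mult_ac)
  also have "\<not> [1 = inv_mod x] (mod int p)"
  proof
    assume "[1 = inv_mod x] (mod int p)"
    hence "[x * 1 = 1] (mod int p)"
      using inv_mod[OF assms(1)] by (meson cong_scalar_left cong_trans)
    thus False using assms(2) by (simp add: cong_iff_dvd_diff)
  qed
  hence "(\<Sum>y\<in>R. lam (y - 1) * lam (y - inv_mod x)) = -1" by (simp add: sum_lam_quadratic)
  finally have "inner x = - lam (-x) - lam (-1)"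
    by (simp add: inner_def sum_R)
  thus ?thesis using abs_lam_le[of "-x"] abs_lam_le[of "-1"] by linarith
qed

text \<open>The weight involves only x, so the y-sum is \<open>inner x\<close>, and the exceptional
  point x = 1 is killed by \<open>lam (x - 1)\<close>.\<close>

lemma weighted_inner_bound:
  assumes w: "\<And>x. \<bar>w x\<bar> \<le> 1"
  shows "\<bar>\<Sum>x\<in>U. \<Sum>y\<in>U. w x * (lam (x - 1) * lam (y - 1) * lam (1 - x * y))\<bar> \<le> 2 * int p"
proof -
  have "(\<Sum>x\<in>U. \<Sum>y\<in>U. w x * (lam (x - 1) * lam (y - 1) * lam (1 - x * y)))
      = (\<Sum>x\<in>U. w x * lam (x - 1) * inner x)"
    by (simp add: inner_def sum_distrib_left mult_ac)
  also have "\<bar>\<dots>\<bar> \<le> (\<Sum>x\<in>U. \<bar>w x * lam (x - 1) * inner x\<bar>)" by (rule sum_abs)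
  also have "\<dots> \<le> (\<Sum>x\<in>U. 2)"
  proof (rule sum_mono)
    fix x assume x: "x \<in> U"
    show "\<bar>w x * lam (x - 1) * inner x\<bar> \<le> 2"
    proof (cases "int p dvd x - 1")
      case True
      hence "lam (x - 1) = 0" by (simp add: lam_eq_0_iff)
      thus ?thesis by simp
    next
      case False
      have "\<bar>w x * lam (x - 1)\<bar> * \<bar>inner x\<bar> \<le> 1 * 2"
        by (intro mult_mono abs_mult_le_1 w abs_lam_le inner_bound U_not_dvd x False) auto
      thus ?thesis by (simp add: abs_mult)
    qed
  qed
  finally show ?thesis using p_gt_2 by simp
qed

definition T_sum :: int where
  "T_sum = (\<Sum>a\<in>U. \<Sum>b\<in>U. lam (a\<^sup>2 - 1) * lam (b\<^sup>2 - 1) * lam (1 - a\<^sup>2 * b\<^sup>2))"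

text \<open>Replacing both squares by the weights \<open>1 + lam x\<close> and
  \<open>1 + lam y\<close> yields four sums: those weighted by 1, \<open>lam x\<close> and
  \<open>lam y\<close> are at most 2p each, and the one weighted by \<open>lam x * lam y\<close> is
  D. Hence 6p + 6p.\<close>

lemma T_sum_bound: "\<bar>T_sum\<bar> \<le> 12 * int p"
proof -
  define g where "g = (\<lambda>x y. lam (x - 1) * lam (y - 1) * lam (1 - x * y))"
  have "T_sum = (\<Sum>a\<in>U. \<Sum>y\<in>U. (1 + lam y) * g (a\<^sup>2) y)"
    unfolding T_sum_def
  proof (rule sum.cong[OF refl])
    fix a
    have "periodic (g (a\<^sup>2))" unfolding g_def by (intro periodic_intros)
    from sum_squares_U[OF this]
    show "(\<Sum>b\<in>U. lam (a\<^sup>2 - 1) * lam (b\<^sup>2 - 1) * lam (1 - a\<^sup>2 * b\<^sup>2)) = (\<Sum>y\<in>U. (1 + lam y) * g (a\<^sup>2) y)"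
      by (simp add: g_def)
  qed
  also have "\<dots> = (\<Sum>x\<in>U. (1 + lam x) * (\<Sum>y\<in>U. (1 + lam y) * g x y))"
  proof -
    have "periodic (\<lambda>x. \<Sum>y\<in>U. (1 + lam y) * g x y)"
      unfolding g_def by (intro periodic_intros)
    from sum_squares_U[OF this] show ?thesis by simp
  qed
  also have "\<dots> = (\<Sum>x\<in>U. \<Sum>y\<in>U. 1 * g x y) + (\<Sum>x\<in>U. \<Sum>y\<in>U. lam x * g x y)
      + (\<Sum>x\<in>U. \<Sum>y\<in>U. lam y * g x y) + (\<Sum>x\<in>U. \<Sum>y\<in>U. lam x * lam y * g x y)"
    unfolding sum_distrib_left sum.distrib[symmetric]
    by (intro sum.cong refl) (simp add: algebra_simps)
  also have "(\<Sum>x\<in>U. \<Sum>y\<in>U. lam y * g x y) = (\<Sum>x\<in>U. \<Sum>y\<in>U. lam x * g x y)"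
    by (subst sum.swap) (simp add: g_def mult_ac)
  also have "(\<Sum>x\<in>U. \<Sum>y\<in>U. lam x * lam y * g x y) = D_sum"
    unfolding D_sum_def by (subst sum.swap) (simp add: sum_R g_def mult_ac)
  finally have "T_sum = (\<Sum>x\<in>U. \<Sum>y\<in>U. 1 * g x y) + 2 * (\<Sum>x\<in>U. \<Sum>y\<in>U. lam x * g x y) + D_sum" by simp
  moreover have "\<bar>\<Sum>x\<in>U. \<Sum>y\<in>U. 1 * g x y\<bar> \<le> 2 * int p"
    unfolding g_def using weighted_inner_bound[of "\<lambda>_. 1"] by simp
  moreover have "\<bar>\<Sum>x\<in>U. \<Sum>y\<in>U. lam x * g x y\<bar> \<le> 2 * int p"
    unfolding g_def using weighted_inner_bound[of lam] abs_lam_le by simp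
  ultimately show ?thesis using D_sum_bound by linarith
qed

text \<open>Inverting a and b changes each of the three arguments by a square and a sign. Each sign
  costs \<open>lam (-1) = -1\<close>, so T = (-1)^3 T.\<close>

lemma T_sum_eq_0:
  assumes "lam (-1) = -1"
  shows "T_sum = 0"
proof -
  define h where "h = (\<lambda>a b. lam (a\<^sup>2 - 1) * lam (b\<^sup>2 - 1) * lam (1 - a\<^sup>2 * b\<^sup>2))"
  have inv: "lam ((inv_mod a)\<^sup>2 - 1) = - lam (a\<^sup>2 - 1)" if "a \<in> U" for a
  proof -
    have a: "\<not> int p dvd a" using that by (rule U_not_dvd)
    have "lam (a\<^sup>2 * ((inv_mod a)\<^sup>2 - 1)) = lam (1 - a\<^sup>2)"
      using cong_diff[OF cong_pow[OF inv_mod[OF a], of 2] cong_refl[of "a\<^sup>2"]]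
      by (intro lam_cong) (simp add: algebra_simps)
    also have "\<dots> = - lam (a\<^sup>2 - 1)" using lam_diff_commute[of 1 "a\<^sup>2"] assms by simp
    finally show ?thesis by (simp add: lam_mult lam_square[OF a])
  qed
  have inv2: "lam (1 - (inv_mod a)\<^sup>2 * (inv_mod b)\<^sup>2) = - lam (1 - a\<^sup>2 * b\<^sup>2)" if "a \<in> U" "b \<in> U" for a b
  proof -
    have a: "\<not> int p dvd a" and b: "\<not> int p dvd b" using that U_not_dvd by auto
    have "[(a * inv_mod a)\<^sup>2 * (b * inv_mod b)\<^sup>2 = 1\<^sup>2 * 1\<^sup>2] (mod int p)"
      by (intro cong_pow cong_mult inv_mod a b)
    from cong_diff[OF cong_refl[of "a\<^sup>2 * b\<^sup>2"] this]
    have "lam (a\<^sup>2 * b\<^sup>2 * (1 - (inv_mod a)\<^sup>2 * (inv_mod b)\<^sup>2)) = lam (a\<^sup>2 * b\<^sup>2 - 1)"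
      by (intro lam_cong) (simp add: algebra_simps)
    also have "\<dots> = - lam (1 - a\<^sup>2 * b\<^sup>2)" using lam_diff_commute[of "a\<^sup>2 * b\<^sup>2" 1] assms by simp
    finally show ?thesis by (simp add: lam_mult lam_square[OF a] lam_square[OF b])
  qed
  have "T_sum = (\<Sum>a\<in>U. \<Sum>b\<in>U. h (inv_mod a) b)"
    unfolding T_sum_def h_def by (rule sum_inv[symmetric]) (intro periodic_intros)
  also have "\<dots> = (\<Sum>a\<in>U. \<Sum>b\<in>U. h (inv_mod a) (inv_mod b))"
  proof (rule sum.cong[OF refl])
    fix a show "(\<Sum>b\<in>U. h (inv_mod a) b) = (\<Sum>b\<in>U. h (inv_mod a) (inv_mod b))"
      unfolding h_def by (rule sum_inv[symmetric]) (intro periodic_intros)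
  qed
  also have "\<dots> = (\<Sum>a\<in>U. \<Sum>b\<in>U. - h a b)"
    by (intro sum.cong refl) (simp add: h_def inv inv2)
  also have "\<dots> = - T_sum" by (simp add: T_sum_def h_def sum_negf)
  finally show ?thesis by simp
qed

end

section \<open>Dirichlet characters modulo a prime\<close>

text \<open>Only i < n numbers satisfy z^i = 1, so some n-th root w does not; multiplication by w
  permutes the n-th roots and scales the sum by w^i.\<close>

lemma sum_powers_roots_of_unity:
  fixes n i :: nat
  assumes "0 < i" "i < n"
  shows "(\<Sum>z\<in>{z::complex. z ^ n = 1}. z ^ i) = 0"
proof -
  let ?Z = "{z::complex. z ^ n = 1}"
  have fin: "finite {z::complex. z ^ i = 1}"
    using card_roots_unity_eq[of i] assms by (intro card_ge_0_finite) auto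
  have "\<not> ?Z \<subseteq> {z. z ^ i = 1}"
    using card_mono[OF fin, of ?Z] card_roots_unity_eq[of i] card_roots_unity_eq[of n] assms by auto
  then obtain w :: complex where w: "w ^ n = 1" "w ^ i \<noteq> 1" by blast
  have w0: "w \<noteq> 0" using w(1) assms by (auto simp: power_0_left)
  have "(\<Sum>z\<in>?Z. z ^ i) = (\<Sum>z\<in>?Z. (w * z) ^ i)"
    by (rule sum.reindex_bij_witness[of _ "\<lambda>z. w * z" "\<lambda>z. z / w"])
       (auto simp: w0 w power_mult_distrib power_divide)
  also have "\<dots> = w ^ i * (\<Sum>z\<in>?Z. z ^ i)" by (simp add: power_mult_distrib sum_distrib_left)
  finally show ?thesis using w(2) by simp
qed

context odd_prime begin

lemma coprime_p_iff: "coprime a p \<longleftrightarrow> \<not> p dvd a"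
  using prime_p by (metis coprime_absorb_right coprime_commute not_prime_unit prime_imp_coprime)

lemma character_cong:
  assumes "dirichlet_character p \<chi>" "[a = b] (mod p)"
  shows "\<chi> a = \<chi> b"
proof -
  have add: "\<chi> (a + k * p) = \<chi> a" for a k
  proof (induction k)
    case (Suc k)
    have "\<chi> (a + Suc k * p) = \<chi> (a + k * p + p)" by (simp add: algebra_simps)
    thus ?case using assms(1) Suc by (simp add: dirichlet_character_def)
  qed simp
  have "\<chi> (a mod p) = \<chi> a" for a
    using add[of "a mod p" "a div p"] by simp
  thus ?thesis using assms(2) unfolding cong_def by metis
qed

lemma character_mult: "dirichlet_character p \<chi> \<Longrightarrow> \<chi> (a * b) = \<chi> a * \<chi> b"
  by (simp add: dirichlet_character_def)

lemma character_eq_0_iff: "dirichlet_character p \<chi> \<Longrightarrow> \<chi> a = 0 \<longleftrightarrow> p dvd a"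
  by (simp add: dirichlet_character_def coprime_p_iff)

lemma character_1: "dirichlet_character p \<chi> \<Longrightarrow> \<chi> 1 = 1"
  using character_mult[of \<chi> 1 1] character_eq_0_iff[of \<chi> 1] p_gt_2 by auto

lemma character_power: "dirichlet_character p \<chi> \<Longrightarrow> \<chi> (a ^ k) = \<chi> a ^ k"
  by (induction k) (use character_1 in \<open>auto simp: character_mult\<close>)

lemma character_power_p_minus_1:
  assumes "dirichlet_character p \<chi>" "\<not> p dvd a"
  shows "\<chi> a ^ (p - 1) = 1"
  using character_cong[OF assms(1) fermat_theorem[OF prime_p assms(2)]]
  by (simp only: character_power[OF assms(1)] character_1[OF assms(1)])

lemma norm_character:
  assumes "dirichlet_character p \<chi>" "\<not> p dvd a"
  shows "norm (\<chi> a) = 1"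
  using power_eq_1_iff[OF character_power_p_minus_1[OF assms]] p_gt_2 by simp

text \<open>A primitive root has order p - 1, which gives the rule for exponents, and its powers
  exhaust the totatives.\<close>

lemma primitive_root_powers:
  obtains g where "\<not> p dvd g"
    and "\<And>a. \<not> p dvd a \<Longrightarrow> \<exists>i<p - 1. [g ^ i = a] (mod p)"
    and "\<And>i j. [g ^ i = g ^ j] (mod p) \<longleftrightarrow> [i = j] (mod (p - 1))"
proof -
  obtain g where g: "residue_primroot p g" using prime_primitive_root_exists prime_p prime_gt_1_nat by blast
  have tot: "totient p = p - 1" using prime_p by (rule totient_prime)
  have cop: "coprime p g" and ord: "ord p g = p - 1"
    using g tot by (auto simp: residue_primroot_def)
  have img: "(\<lambda>i. g ^ i mod p) ` {..<p - 1} = totatives p"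
    using residue_primroot_is_generator[OF _ g] p_gt_2 tot by (auto simp: bij_betw_def)
  show ?thesis
  proof (rule that)
    show "\<not> p dvd g" using cop by (simp add: coprime_commute coprime_p_iff)
    show "[g ^ i = g ^ j] (mod p) \<longleftrightarrow> [i = j] (mod (p - 1))" for i j
      using order_divides_expdiff[OF cop, of i j] ord by simp
    fix a assume a: "\<not> p dvd a"
    hence "a mod p \<in> totatives p"
      using p_gt_2 by (auto simp: totatives_def coprime_p_iff dvd_eq_mod_eq_0 less_imp_le)
    then obtain i where "i < p - 1" "a mod p = g ^ i mod p" unfolding img[symmetric] by auto
    thus "\<exists>i<p - 1. [g ^ i = a] (mod p)" by (auto simp: cong_def)
  qed
qed

text \<open>A character is determined by its value at the generator, a (p - 1)-th root of unity by
  Fermat; conversely a root z defines a character by raising z to the discrete logarithm.\<close>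

lemma bij_betw_characters_roots_of_unity:
  assumes ndvd: "\<not> p dvd g"
    and gen: "\<And>a. \<not> p dvd a \<Longrightarrow> \<exists>i<p - 1. [g ^ i = a] (mod p)"
    and exp: "\<And>i j. [g ^ i = g ^ j] (mod p) \<longleftrightarrow> [i = j] (mod (p - 1))"
  shows "bij_betw (\<lambda>\<chi>. \<chi> g) (dirichlet_characters p) {z. z ^ (p - 1) = 1}"
proof (rule bij_betw_imageI)
  show "inj_on (\<lambda>\<chi>. \<chi> g) (dirichlet_characters p)"
  proof (rule inj_onI, rule ext)
    fix \<chi> \<psi> a
    assume cp: "\<chi> \<in> dirichlet_characters p" "\<psi> \<in> dirichlet_characters p" and eq: "\<chi> g = \<psi> g"
    hence c: "dirichlet_character p \<chi>" "dirichlet_character p \<psi>" by (auto simp: dirichlet_characters_def)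
    show "\<chi> a = \<psi> a"
    proof (cases "p dvd a")
      case True
      thus ?thesis using c by (metis character_eq_0_iff)
    next
      case False
      then obtain i where i: "[g ^ i = a] (mod p)" using gen by blast
      have "\<chi> a = \<chi> g ^ i" "\<psi> a = \<psi> g ^ i"
        using character_cong[OF c(1) i] character_cong[OF c(2) i] c by (auto simp: character_power)
      thus ?thesis using eq by simp
    qed
  qed
next
  have "\<exists>\<chi>. dirichlet_character p \<chi> \<and> \<chi> g = z" if z: "z ^ (p - 1) = 1" for z :: complex
  proof -
    \<comment> \<open>A discrete logarithm. It depends only on the residue class of a, and since
      z^(p - 1) = 1 every admissible exponent gives the same power of z.\<close>
    define idx where "idx = (\<lambda>a. SOME i. [g ^ i = a] (mod p))"
    define \<chi> where "\<chi> = (\<lambda>a. if p dvd a then 0 else z ^ idx a)"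
    have z0: "z \<noteq> 0" using z p_gt_2 by (auto simp: power_0_left)
    have pow: "z ^ i = z ^ j" if "[i = j] (mod (p - 1))" for i j
    proof -
      have "z ^ k = z ^ (k mod (p - 1))" for k
      proof -
        have "z ^ k = z ^ ((p - 1) * (k div (p - 1)) + k mod (p - 1))" by simp
        also have "\<dots> = z ^ (k mod (p - 1))" unfolding power_add power_mult z by simp
        finally show ?thesis .
      qed
      thus ?thesis using that unfolding cong_def by metis
    qed
    have idx: "[g ^ idx a = a] (mod p)" if "\<not> p dvd a" for a
      unfolding idx_def using gen[OF that] by (metis (mono_tags) someI)
    have chi: "\<chi> a = z ^ i" if "[g ^ i = a] (mod p)" "\<not> p dvd a" for a i
    proof -
      have "[g ^ idx a = g ^ i] (mod p)" using idx[OF that(2)] that(1) by (metis cong_sym cong_trans)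
      thus ?thesis using that(2) pow exp by (simp add: \<chi>_def)
    qed
    have "dirichlet_character p \<chi>"
      unfolding dirichlet_character_def
    proof (intro conjI allI)
      fix a b
      show "\<chi> (a * b) = \<chi> a * \<chi> b"
      proof (cases "p dvd a * b")
        case True
        thus ?thesis using prime_dvd_mult_iff[OF prime_p] by (auto simp: \<chi>_def)
      next
        case False
        hence ab: "\<not> p dvd a" "\<not> p dvd b" by auto
        have "[g ^ (idx a + idx b) = a * b] (mod p)"
          unfolding power_add by (intro cong_mult idx ab)
        hence "\<chi> (a * b) = z ^ (idx a + idx b)" using False by (rule chi)
        thus ?thesis using ab by (simp add: \<chi>_def power_add)
      qed
    next
      fix a show "\<chi> (a + p) = \<chi> a"
      proof -
        have "idx (a + p) = idx a" unfolding idx_def by (simp add: cong_def)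
        thus ?thesis by (simp add: \<chi>_def)
      qed
    next
      fix a show "\<chi> a = 0 \<longleftrightarrow> \<not> coprime a p"
        using z0 by (simp add: \<chi>_def coprime_p_iff)
    qed
    moreover have "\<chi> g = z" using chi[of 1 g] ndvd by simp
    ultimately show ?thesis by blast
  qed
  thus "(\<lambda>\<chi>. \<chi> g) ` dirichlet_characters p = {z. z ^ (p - 1) = 1}"
    using character_power_p_minus_1[OF _ ndvd] by (auto simp: dirichlet_characters_def image_iff)
qed

text \<open>With a = g^i the sum becomes that of z^i over the (p - 1)-th roots of unity; i < p - 1
  makes a = 1 equivalent to i = 0.\<close>

lemma character_orthogonality:
  assumes "\<not> p dvd a"
  shows "(\<Sum>\<chi>\<in>dirichlet_characters p. \<chi> a) = (if [a = 1] (mod p) then of_nat (p - 1) else 0)"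
proof -
  obtain g where ndvd: "\<not> p dvd g"
    and gen: "\<And>a. \<not> p dvd a \<Longrightarrow> \<exists>i<p - 1. [g ^ i = a] (mod p)"
    and exp: "\<And>i j. [g ^ i = g ^ j] (mod p) \<longleftrightarrow> [i = j] (mod (p - 1))"
    by (rule primitive_root_powers) blast
  obtain i where i: "i < p - 1" "[g ^ i = a] (mod p)" using gen[OF assms] by blast
  have a1: "[a = 1] (mod p) \<longleftrightarrow> i = 0"
  proof -
    have "[a = 1] (mod p) \<longleftrightarrow> [g ^ i = g ^ 0] (mod p)"
      using i(2) by (auto intro: cong_trans cong_sym)
    also have "\<dots> \<longleftrightarrow> [i = 0] (mod (p - 1))" by (rule exp)
    also have "\<dots> \<longleftrightarrow> i = 0" using i(1) by (simp add: cong_def)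
    finally show ?thesis .
  qed
  have "(\<Sum>\<chi>\<in>dirichlet_characters p. \<chi> a) = (\<Sum>\<chi>\<in>dirichlet_characters p. \<chi> g ^ i)"
    using character_cong[OF _ i(2)] by (intro sum.cong) (auto simp: dirichlet_characters_def character_power)
  also have "\<dots> = (\<Sum>z\<in>{z. z ^ (p - 1) = 1}. z ^ i)"
    by (rule sum.reindex_bij_betw[OF bij_betw_characters_roots_of_unity[OF ndvd gen exp]])
  also have "\<dots> = (if i = 0 then of_nat (p - 1) else 0)"
    using sum_powers_roots_of_unity[of i "p - 1"] i(1) card_roots_unity_eq[of "p - 1"] p_gt_2 by auto
  finally show ?thesis by (simp only: a1)
qed

text \<open>Carries a character from the natural numbers to the integers, where the reindexing
  lemmas for periodic functions apply.\<close>

definition ext :: "(nat \<Rightarrow> complex) \<Rightarrow> int \<Rightarrow> complex" where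
  "ext \<chi> x = \<chi> (nat (x mod int p))"

lemma nat_mod_cong: "[int (nat (x mod int p)) = x] (mod int p)"
  using p_gt_2 by (simp add: cong_def)

lemma nat_mod_dvd_iff: "p dvd nat (x mod int p) \<longleftrightarrow> int p dvd x"
  using cong_dvd_iff[OF nat_mod_cong[of x]] by (simp only: int_dvd_int_iff)

lemma periodic_ext: "periodic (ext \<chi>)"
  by (rule periodicI) (simp add: ext_def cong_def)

lemma ext_mult:
  assumes "dirichlet_character p \<chi>"
  shows "ext \<chi> (x * y) = ext \<chi> x * ext \<chi> y"
proof -
  have "[int (nat (x * y mod int p)) = int (nat (x mod int p)) * int (nat (y mod int p))] (mod int p)"
    by (meson cong_mult cong_sym cong_trans nat_mod_cong)
  hence "[nat (x * y mod int p) = nat (x mod int p) * nat (y mod int p)] (mod p)"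
    by (simp flip: cong_int_iff)
  thus ?thesis unfolding ext_def using character_cong[OF assms] character_mult[OF assms] by metis
qed

lemma norm_ext: "dirichlet_character p \<chi> \<Longrightarrow> \<not> int p dvd x \<Longrightarrow> norm (ext \<chi> x) = 1"
  by (simp add: ext_def norm_character nat_mod_dvd_iff)

lemma ext_orthogonality:
  assumes "\<not> int p dvd x"
  shows "(\<Sum>\<chi>\<in>dirichlet_characters p. ext \<chi> x) = (if [x = 1] (mod int p) then of_nat (p - 1) else 0)"
proof -
  have "[nat (x mod int p) = 1] (mod p) \<longleftrightarrow> [int (nat (x mod int p)) = 1] (mod int p)"
    by (metis cong_int_iff of_nat_1)
  also have "\<dots> \<longleftrightarrow> [x = 1] (mod int p)"
    using nat_mod_cong[of x] by (meson cong_sym cong_trans)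
  finally show ?thesis
    unfolding ext_def using character_orthogonality[of "nat (x mod int p)"] assms
    by (simp add: nat_mod_dvd_iff)
qed

end

section \<open>Gauss sums\<close>

locale gauss_modulus = odd_prime +
  fixes n :: int
  assumes n_not_dvd: "\<not> int p dvd n"
begin

text \<open>The integer n is absorbed into this additive character; once the sums over squares are
  evaluated, n survives only in \<open>W\<close>.\<close>

definition e :: "int \<Rightarrow> complex" where
  "e x = cis (2 * pi * real_of_int (n * x) / real p)"

lemma e_add: "e (x + y) = e x * e y"
  by (simp add: e_def cis_mult add_divide_distrib ring_distribs)

lemma e_0 [simp]: "e 0 = 1"
  by (simp add: e_def)

lemma cnj_e: "cnj (e x) = e (- x)"
  by (simp add: e_def cis_cnj)

text \<open>The hypothesis on n enters here: p divides n x only if it divides x, so \<open>e\<close>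
  is a nontrivial character.\<close>

lemma e_eq_1_iff: "e x = 1 \<longleftrightarrow> int p dvd x"
proof
  assume "int p dvd x"
  then obtain k where "x = int p * k" by blast
  hence "2 * pi * real_of_int (n * x) / real p = 2 * pi * of_int (n * k)"
    using p_gt_2 by simp
  thus "e x = 1" unfolding e_def by (metis Ints_of_int cis_multiple_2pi)
next
  assume "e x = 1"
  hence "cos (2 * pi * real_of_int (n * x) / real p) = 1" by (simp add: e_def complex_eq_iff)
  then obtain k :: int where k: "2 * pi * real_of_int (n * x) / real p = of_int k * 2 * pi"
    unfolding cos_one_2pi_int by blast
  have "real_of_int (n * x) = (2 * pi * real_of_int (n * x) / real p) * (real p / (2 * pi))"
    using p_gt_2 by simp
  also have "\<dots> = real_of_int (k * int p)" unfolding k by simp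
  finally have "n * x = k * int p" by (simp only: of_int_eq_iff)
  hence "int p dvd n * x" by simp
  thus "int p dvd x" using prime_dvd_mult_iff[OF prime_int_p] n_not_dvd by blast
qed

lemma periodic_e: "periodic e"
proof (rule periodicI)
  fix x y assume "[x = y] (mod int p)"
  hence "e (x - y) = 1" by (simp add: e_eq_1_iff cong_iff_dvd_diff)
  thus "e x = e y" using e_add[of "x - y" y] by simp
qed

lemma periodic_e_comp:
  "(\<And>x y. [x = y] (mod int p) \<Longrightarrow> [h x = h y] (mod int p)) \<Longrightarrow> periodic (\<lambda>x. e (h x))"
  using periodicD[OF periodic_e] by (auto intro: periodicI)

text \<open>If \<open>e m\<close> is not 1, shifting x by 1 multiplies the complete sum by
  \<open>e m\<close>, which forces it to vanish.\<close>

lemma sum_e: "(\<Sum>x\<in>R. e (m * x)) = (if int p dvd m then of_nat p else 0)"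
proof (cases "int p dvd m")
  case True
  hence "e (m * x) = 1" for x by (simp add: e_eq_1_iff)
  thus ?thesis using True by simp
next
  case False
  have "(\<Sum>x\<in>R. e (m * x)) = (\<Sum>x\<in>R. e (m * (x + 1)))"
    by (rule sum_shift[symmetric]) (intro periodic_e_comp periodic_intros)
  also have "\<dots> = (\<Sum>x\<in>R. e (m * x)) * e m"
    by (simp add: ring_distribs e_add sum_distrib_right)
  finally show ?thesis using False by (simp add: e_eq_1_iff)
qed

definition W :: complex where
  "W = (\<Sum>x\<in>R. of_int (lam x) * e x)"

text \<open>Grouping by squares leaves the sum of \<open>e (m * x)\<close> plus the same sum twisted
  by \<open>lam x\<close>. For m prime to p, rescaling x turns the twisted sum into
  \<open>lam m * W\<close>; otherwise it is the vanishing sum of \<open>lam\<close>.\<close>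

lemma sum_e_squares:
  "(\<Sum>b\<in>R. e (m * b\<^sup>2)) = (if int p dvd m then of_nat p else 0) + of_int (lam m) * W"
proof -
  have per: "periodic (\<lambda>x. of_int (lam x) * e x :: complex)"
    by (intro periodic_intros periodic_e periodicI arg_cong[of _ _ of_int] lam_cong)
  have "(\<Sum>b\<in>R. e (m * b\<^sup>2)) = (\<Sum>x\<in>R. (1 + of_int (lam x)) * e (m * x))"
    by (rule sum_squares) (intro periodic_e_comp periodic_intros)
  also have "\<dots> = (if int p dvd m then of_nat p else 0) + (\<Sum>x\<in>R. of_int (lam x) * e (m * x))"
    unfolding sum_e[symmetric] by (simp add: ring_distribs sum.distrib)
  also have "(\<Sum>x\<in>R. of_int (lam x) * e (m * x)) = of_int (lam m) * W"
  proof (cases "int p dvd m")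
    case True
    hence "e (m * x) = 1" for x by (simp add: e_eq_1_iff)
    moreover have "(\<Sum>x\<in>R. complex_of_int (lam x)) = 0"
      using sum_lam by (metis of_int_0 of_int_sum)
    ultimately show ?thesis using True lam_eq_0_iff[of m] by simp
  next
    case False
    have "W = (\<Sum>x\<in>R. of_int (lam (m * x)) * e (m * x))"
      unfolding W_def by (rule sum_scale[symmetric, OF per False])
    also have "\<dots> = of_int (lam m) * (\<Sum>x\<in>R. of_int (lam x) * e (m * x))"
      by (simp add: lam_mult sum_distrib_left mult.assoc)
    finally have "of_int (lam m) * W = of_int (lam m * lam m) * (\<Sum>x\<in>R. of_int (lam x) * e (m * x))"
      by (simp add: mult.assoc)
    thus ?thesis by (simp only: lam_sq[OF False] of_int_1 mult_1_left)
  qed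
  finally show ?thesis .
qed

lemma W_eq: "W = (\<Sum>b\<in>R. e (b\<^sup>2))"
  using sum_e_squares[of 1] p_gt_2 by simp

text \<open>Conjugation turns b^2 into -b^2, the case m = -1 of
  \<open>sum_e_squares\<close>.\<close>

lemma cnj_W: "cnj W = of_int (lam (-1)) * W"
proof -
  have "cnj W = (\<Sum>b\<in>R. e ((-1) * b\<^sup>2))" by (simp add: W_eq cnj_e)
  thus ?thesis unfolding sum_e_squares using p_gt_2 by simp
qed

lemma not_dvd_2: "\<not> int p dvd 2"
  using p_gt_2 zdvd_imp_le[of "int p" 2] by auto

text \<open>Shifting a by b turns a^2 - b^2 into a^2 + 2ab; the sum over b then vanishes unless a =
  0, because p is odd.\<close>

lemma W_cnj_W: "W * cnj W = of_nat p"
proof -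
  have "W * cnj W = (\<Sum>b\<in>R. \<Sum>a\<in>R. e (a\<^sup>2) * e (- (b\<^sup>2)))"
    unfolding W_eq by (subst sum.swap) (simp add: sum_product cnj_e)
  also have "\<dots> = (\<Sum>b\<in>R. \<Sum>a\<in>R. e ((a + b)\<^sup>2) * e (- (b\<^sup>2)))"
    by (intro sum.cong refl sum_shift[symmetric]) (intro periodic_e_comp periodic_intros)
  also have "\<dots> = (\<Sum>b\<in>R. \<Sum>a\<in>R. e (a\<^sup>2) * e ((2 * a) * b))"
  proof (intro sum.cong refl)
    fix a b :: int
    have "(a + b)\<^sup>2 + - (b\<^sup>2) = a\<^sup>2 + 2 * a * b" by (simp add: power2_eq_square algebra_simps)
    thus "e ((a + b)\<^sup>2) * e (- (b\<^sup>2)) = e (a\<^sup>2) * e ((2 * a) * b)" by (simp flip: e_add)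
  qed
  also have "\<dots> = (\<Sum>a\<in>R. e (a\<^sup>2) * (\<Sum>b\<in>R. e ((2 * a) * b)))"
    by (subst sum.swap) (simp only: sum_distrib_left)
  also have "\<dots> = (\<Sum>a\<in>R. e (a\<^sup>2) * (if int p dvd 2 * a then of_nat p else 0))"
    by (simp only: sum_e)
  also have "\<dots> = (\<Sum>a\<in>U. 0) + of_nat p"
  proof -
    have "\<not> int p dvd 2 * a" if "a \<in> U" for a
      using that U_not_dvd not_dvd_2 prime_dvd_mult_iff[OF prime_int_p] by blast
    hence "(\<Sum>a\<in>U. e (a\<^sup>2) * (if int p dvd 2 * a then of_nat p else 0)) = (\<Sum>a\<in>U. 0)"
      by (intro sum.cong refl) auto
    thus ?thesis unfolding sum_R by simp
  qed
  finally show ?thesis by simp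
qed

lemma norm_W: "norm W = sqrt (real p)"
proof -
  have "(norm W)\<^sup>2 = real p"
    using W_cnj_W complex_norm_square[of W] by (metis of_real_eq_iff of_real_of_nat_eq)
  thus ?thesis by (metis norm_ge_zero real_sqrt_abs2 power2_eq_square abs_of_nonneg)
qed

lemma lam_minus_1_sq: "lam (-1) * lam (-1) = 1"
  using p_gt_2 by (intro lam_sq) simp

lemma W_square: "W\<^sup>2 = of_int (lam (-1)) * of_nat p"
proof -
  have "of_int (lam (-1)) * (W * cnj W) = of_int (lam (-1) * lam (-1)) * W\<^sup>2"
    by (simp add: cnj_W power2_eq_square mult_ac)
  thus ?thesis by (simp add: lam_minus_1_sq W_cnj_W)
qed

section \<open>Squared modulus of the generalized Gauss sum\<close>

definition delta :: "int \<Rightarrow> complex" where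
  "delta a = (if int p dvd a\<^sup>2 - 1 then 1 else 0)"

definition L :: "int \<Rightarrow> complex" where
  "L a = of_int (lam (a\<^sup>2 - 1))"

text \<open>The value of the sum of \<open>e ((a^2 - 1) * b^2)\<close> over b in \<open>U\<close>,
  by \<open>sum_e_squares\<close>; the -1 removes b = 0.\<close>

definition c :: "int \<Rightarrow> complex" where
  "c a = of_nat p * delta a + (W * L a - 1)"

lemma gen_gauss_sum_eq:
  assumes chi: "dirichlet_character p \<chi>"
  shows "gen_gauss_sum n \<chi> p = (\<Sum>x\<in>U. ext \<chi> x * e (x\<^sup>2))"
proof -
  have "gen_gauss_sum n \<chi> p = (\<Sum>a=1..p. \<chi> a * e ((int a)\<^sup>2))"
    unfolding gen_gauss_sum_def e_def cis_conv_exp by (intro sum.cong refl) (simp add: mult_ac)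
  \<comment> \<open>The last term drops out because the character vanishes at p.\<close>
  also have "\<dots> = (\<Sum>a\<in>{1..<p}. \<chi> a * e ((int a)\<^sup>2))"
    by (rule sum.mono_neutral_right) (use character_eq_0_iff[OF chi, of p] in \<open>auto simp: not_less\<close>)
  also have "\<dots> = (\<Sum>x\<in>U. ext \<chi> x * e (x\<^sup>2))"
    by (rule sum.reindex_bij_witness[of _ nat int]) (auto simp: ext_def)
  finally show ?thesis .
qed

text \<open>In the product of the sum and its conjugate, replace a by b a. The value of the
  character at b has modulus 1 and cancels, so only \<open>e ((a^2 - 1) * b^2)\<close> depends on
  b.\<close>

lemma norm_gauss_sum_square:
  assumes chi: "dirichlet_character p \<chi>"
  shows "of_real ((norm (gen_gauss_sum n \<chi> p))\<^sup>2) = (\<Sum>a\<in>U. ext \<chi> a * c a)"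
proof -
  have "of_real ((norm (gen_gauss_sum n \<chi> p))\<^sup>2)
      = (\<Sum>x\<in>U. ext \<chi> x * e (x\<^sup>2)) * cnj (\<Sum>x\<in>U. ext \<chi> x * e (x\<^sup>2))"
    unfolding complex_norm_square gen_gauss_sum_eq[OF chi] ..
  also have "\<dots> = (\<Sum>b\<in>U. \<Sum>a\<in>U. ext \<chi> a * e (a\<^sup>2) * cnj (ext \<chi> b * e (b\<^sup>2)))"
    by (subst sum.swap) (simp add: sum_product)
  also have "\<dots> = (\<Sum>b\<in>U. \<Sum>a\<in>U. ext \<chi> (b * a) * e ((b * a)\<^sup>2) * cnj (ext \<chi> b * e (b\<^sup>2)))"
    by (intro sum.cong refl sum_scale_U[symmetric] U_not_dvd)
       (intro periodic_e_comp periodic_ext periodic_intros)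
  also have "\<dots> = (\<Sum>b\<in>U. \<Sum>a\<in>U. ext \<chi> a * e ((a\<^sup>2 - 1) * b\<^sup>2))"
  proof (intro sum.cong refl)
    fix a b assume b: "b \<in> U"
    have "ext \<chi> b * cnj (ext \<chi> b) = 1"
      using norm_ext[OF chi U_not_dvd[OF b]] by (simp flip: complex_norm_square)
    moreover have "e ((b * a)\<^sup>2) * e (- (b\<^sup>2)) = e ((a\<^sup>2 - 1) * b\<^sup>2)"
      by (simp flip: e_add add: algebra_simps)
    moreover have "ext \<chi> (b * a) * e ((b * a)\<^sup>2) * cnj (ext \<chi> b * e (b\<^sup>2))
       = ext \<chi> a * (ext \<chi> b * cnj (ext \<chi> b)) * (e ((b * a)\<^sup>2) * e (- (b\<^sup>2)))"
      by (simp add: ext_mult[OF chi] cnj_e mult_ac)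
    ultimately show "ext \<chi> (b * a) * e ((b * a)\<^sup>2) * cnj (ext \<chi> b * e (b\<^sup>2)) = ext \<chi> a * e ((a\<^sup>2 - 1) * b\<^sup>2)"
      by simp
  qed
  also have "\<dots> = (\<Sum>a\<in>U. ext \<chi> a * (\<Sum>b\<in>U. e ((a\<^sup>2 - 1) * b\<^sup>2)))"
    by (subst sum.swap) (simp only: sum_distrib_left)
  also have "\<dots> = (\<Sum>a\<in>U. ext \<chi> a * c a)"
  proof (intro sum.cong refl arg_cong2[of _ _ _ _ "(*)"])
    fix a show "(\<Sum>b\<in>U. e ((a\<^sup>2 - 1) * b\<^sup>2)) = c a"
      using sum_e_squares[of "a\<^sup>2 - 1"] by (auto simp: sum_R c_def delta_def L_def algebra_simps)
  qed
  finally show ?thesis .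
qed

lemma L_cong: "[a = b] (mod int p) \<Longrightarrow> L a = L b"
  unfolding L_def by (intro arg_cong[of _ _ of_int] lam_cong cong_diff cong_pow) auto

lemma delta_cong: "[a = b] (mod int p) \<Longrightarrow> delta a = delta b"
proof -
  assume "[a = b] (mod int p)"
  hence "[a\<^sup>2 - 1 = b\<^sup>2 - 1] (mod int p)" by (intro cong_diff cong_pow cong_refl)
  from cong_dvd_iff[OF this] show ?thesis by (simp add: delta_def)
qed

lemma periodic_c: "periodic c"
  unfolding c_def by (rule periodicI) (simp add: L_cong delta_cong)

text \<open>Exactly one d in \<open>U\<close> solves the congruence, the residue of
  \<open>inv_mod x\<close>; periodicity of \<open>f\<close> removes the reduction.\<close>

lemma sum_triple:
  fixes f :: "int \<Rightarrow> complex"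
  assumes f: "periodic f" and x: "\<not> int p dvd x"
  shows "(\<Sum>d\<in>U. if [x * d = 1] (mod int p) then f d else 0) = f (inv_mod x)"
proof -
  let ?d = "inv_mod x mod int p"
  have dU: "?d \<in> U"
    using U_iff[of ?d] inv_mod_not_dvd[OF x] p_gt_2 by (auto simp: dvd_mod_iff)
  have "[x * d = 1] (mod int p) \<longleftrightarrow> d = ?d" if "d \<in> U" for d
  proof
    assume "[x * d = 1] (mod int p)"
    hence "[x * d = x * inv_mod x] (mod int p)" using inv_mod[OF x] by (meson cong_sym cong_trans)
    hence "[d = inv_mod x] (mod int p)" by (rule cong_mult_cancel[OF x])
    thus "d = ?d" using that by (simp add: cong_def)
  next
    assume "d = ?d"
    hence "[d = inv_mod x] (mod int p)" by (simp add: cong_def)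
    thus "[x * d = 1] (mod int p)" using inv_mod[OF x] by (meson cong_scalar_left cong_trans)
  qed
  hence "(\<Sum>d\<in>U. if [x * d = 1] (mod int p) then f d else 0) = (\<Sum>d\<in>U. if d = ?d then f d else 0)"
    by (intro sum.cong refl) simp
  also have "\<dots> = f ?d" using dU by simp
  finally show ?thesis by (simp add: periodic_mod[OF f])
qed

text \<open>The sum of \<open>c a * c b * c d\<close> over a b d = 1, with d eliminated.\<close>

definition N :: complex where
  "N = (\<Sum>a\<in>U. \<Sum>b\<in>U. c a * c b * c (inv_mod (a * b)))"

text \<open>Cube \<open>norm_gauss_sum_square\<close> and sum over the characters first:
  orthogonality keeps the triples with a b d = 1, with weight p - 1.\<close>

lemma sixth_moment_eq:
  "of_real (\<Sum>\<chi>\<in>dirichlet_characters p. norm (gen_gauss_sum n \<chi> p) ^ 6) = of_nat (p - 1) * N"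
proof -
  have "of_real (\<Sum>\<chi>\<in>dirichlet_characters p. norm (gen_gauss_sum n \<chi> p) ^ 6)
      = (\<Sum>\<chi>\<in>dirichlet_characters p. \<Sum>a\<in>U. \<Sum>b\<in>U. \<Sum>d\<in>U. c a * c b * c d * ext \<chi> (a * b * d))"
    unfolding of_real_sum
  proof (rule sum.cong[OF refl])
    fix \<chi> assume "\<chi> \<in> dirichlet_characters p"
    hence chi: "dirichlet_character p \<chi>" by (simp add: dirichlet_characters_def)
    have "complex_of_real (norm (gen_gauss_sum n \<chi> p) ^ 6) = (of_real ((norm (gen_gauss_sum n \<chi> p))\<^sup>2)) ^ 3"
      by simp
    also have "\<dots> = (\<Sum>a\<in>U. ext \<chi> a * c a) * ((\<Sum>b\<in>U. ext \<chi> b * c b) * (\<Sum>d\<in>U. ext \<chi> d * c d))"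
      unfolding norm_gauss_sum_square[OF chi] by (simp add: power3_eq_cube mult.assoc)
    also have "\<dots> = (\<Sum>a\<in>U. \<Sum>b\<in>U. \<Sum>d\<in>U. c a * c b * c d * ext \<chi> (a * b * d))"
      unfolding sum_product unfolding sum_distrib_left ext_mult[OF chi] by (intro sum.cong refl) (simp only: mult_ac)
    finally show "complex_of_real (norm (gen_gauss_sum n \<chi> p) ^ 6)
      = (\<Sum>a\<in>U. \<Sum>b\<in>U. \<Sum>d\<in>U. c a * c b * c d * ext \<chi> (a * b * d))" .
  qed
  also have "\<dots> = (\<Sum>a\<in>U. \<Sum>b\<in>U. \<Sum>d\<in>U. c a * c b * c d * (\<Sum>\<chi>\<in>dirichlet_characters p. ext \<chi> (a * b * d)))"
    unfolding sum_distrib_left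
    by (subst sum.swap, rule sum.cong[OF refl], subst sum.swap, rule sum.cong[OF refl], rule sum.swap)
  also have "\<dots> = (\<Sum>a\<in>U. \<Sum>b\<in>U. of_nat (p - 1) * (c a * c b * (\<Sum>d\<in>U. if [a * b * d = 1] (mod int p) then c d else 0)))"
  proof (intro sum.cong refl)
    fix a b assume ab: "a \<in> U" "b \<in> U"
    have "(\<Sum>\<chi>\<in>dirichlet_characters p. ext \<chi> (a * b * d)) = of_nat (p - 1) * (if [a * b * d = 1] (mod int p) then 1 else 0)"
      if "d \<in> U" for d
    proof -
      have "\<not> int p dvd a * b * d"
        using ab that U_not_dvd prime_dvd_mult_iff[OF prime_int_p] by blast
      from ext_orthogonality[OF this] show ?thesis by simp
    qed
    hence "(\<Sum>d\<in>U. c a * c b * c d * (\<Sum>\<chi>\<in>dirichlet_characters p. ext \<chi> (a * b * d)))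
        = (\<Sum>d\<in>U. (of_nat (p - 1) * (c a * c b)) * (if [a * b * d = 1] (mod int p) then c d else 0))"
      by (intro sum.cong refl) auto
    thus "(\<Sum>d\<in>U. c a * c b * c d * (\<Sum>\<chi>\<in>dirichlet_characters p. ext \<chi> (a * b * d)))
        = of_nat (p - 1) * (c a * c b * (\<Sum>d\<in>U. if [a * b * d = 1] (mod int p) then c d else 0))"
      by (simp only: sum_distrib_left[symmetric] mult.assoc)
  qed
  also have "\<dots> = (\<Sum>a\<in>U. \<Sum>b\<in>U. of_nat (p - 1) * (c a * c b * c (inv_mod (a * b))))"
  proof (intro sum.cong refl)
    fix a b assume "a \<in> U" "b \<in> U"
    hence "\<not> int p dvd a * b"
      using U_not_dvd prime_dvd_mult_iff[OF prime_int_p] by blast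
    from sum_triple[OF periodic_c this]
    show "of_nat (p - 1) * (c a * c b * (\<Sum>d\<in>U. if [a * b * d = 1] (mod int p) then c d else 0))
        = of_nat (p - 1) * (c a * c b * c (inv_mod (a * b)))" by simp
  qed
  also have "\<dots> = of_nat (p - 1) * N"
    by (simp only: N_def sum_distrib_left)
  finally show ?thesis .
qed

end

section \<open>Evaluation of the sixth moment\<close>

context gauss_modulus begin

section \<open>Behaviour under inversion\<close>

definition s :: complex where "s = of_int (lam (-1))"

definition v :: "int \<Rightarrow> complex" where "v a = W * L a - 1"

text \<open>What \<open>v\<close> becomes when a unit argument is inverted; \<open>v\<close> itself
  is \<open>c\<close> without its \<open>delta\<close> term.\<close>

definition v' :: "int \<Rightarrow> complex" where "v' a = s * W * L a - 1"

lemma s_sq: "s * s = 1"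
  unfolding s_def by (simp add: lam_minus_1_sq flip: of_int_mult)

lemma W_square': "s * W\<^sup>2 = of_nat p"
  using s_sq by (simp add: W_square s_def[symmetric] mult.assoc[symmetric])

lemma inv_mod_square_cong:
  assumes "\<not> int p dvd a"
  shows "[a\<^sup>2 * ((inv_mod a)\<^sup>2 - 1) = 1 - a\<^sup>2] (mod int p)"
  using cong_diff[OF cong_pow[OF inv_mod[OF assms], of 2] cong_refl[of "a\<^sup>2"]]
  by (simp add: algebra_simps)

text \<open>Multiplying a^(-2) - 1 by the square a^2 gives 1 - a^2, and reversing the difference
  costs the sign \<open>s\<close>.\<close>

lemma L_inv:
  assumes a: "\<not> int p dvd a"
  shows "L (inv_mod a) = s * L a"
proof -
  have "lam ((inv_mod a)\<^sup>2 - 1) = lam (a\<^sup>2 * ((inv_mod a)\<^sup>2 - 1))"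
    by (simp add: lam_mult lam_square[OF a])
  also have "\<dots> = lam (1 - a\<^sup>2)" by (rule lam_cong[OF inv_mod_square_cong[OF a]])
  also have "\<dots> = lam (-1) * lam (a\<^sup>2 - 1)" by (rule lam_diff_commute)
  finally show ?thesis by (simp add: L_def s_def)
qed

lemma delta_inv:
  assumes a: "\<not> int p dvd a"
  shows "delta (inv_mod a) = delta a"
proof -
  have "int p dvd (inv_mod a)\<^sup>2 - 1 \<longleftrightarrow> int p dvd a\<^sup>2 * ((inv_mod a)\<^sup>2 - 1)"
    using a prime_dvd_mult_iff[OF prime_int_p] prime_dvd_power[OF prime_int_p] by blast
  also have "\<dots> \<longleftrightarrow> int p dvd 1 - a\<^sup>2"
    by (rule cong_dvd_iff[OF inv_mod_square_cong[OF a]])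
  also have "\<dots> \<longleftrightarrow> int p dvd a\<^sup>2 - 1" by (rule dvd_diff_commute)
  finally show ?thesis by (simp add: delta_def)
qed

lemma v_inv: "\<not> int p dvd a \<Longrightarrow> v (inv_mod a) = v' a"
  by (simp add: v_def v'_def L_inv mult_ac)

lemma c_inv: "\<not> int p dvd a \<Longrightarrow> c (inv_mod a) = of_nat p * delta a + v' a"
  by (simp add: c_def delta_inv v'_def L_inv mult_ac)

lemma c_eq: "c a = of_nat p * delta a + v a"
  by (simp add: c_def v_def)

lemma delta_L: "delta a * L a = 0"
  by (simp add: delta_def L_def lam_eq_0_iff)

lemma L_sq: "L a * L a = 1 - delta a"
  using lam_sq[of "a\<^sup>2 - 1"] by (auto simp: delta_def L_def lam_eq_0_iff simp flip: of_int_mult)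

lemma delta_sq: "delta a * delta a = delta a"
  by (simp add: delta_def)

section \<open>Sums weighted by \<open>delta\<close>\<close>

lemma sum_delta:
  assumes F: "periodic F" and even: "F (-1) = F 1"
  shows "(\<Sum>a\<in>U. delta a * F a) = 2 * F 1"
proof -
  \<comment> \<open>\<open>delta\<close> is supported at 1 and -1, the latter represented in
    \<open>U\<close> by p - 1.\<close>
  have zero: "delta a = 0" if "a \<in> U - {1, int p - 1}" for a
  proof -
    have "\<not> int p dvd a - 1" "\<not> int p dvd a + 1"
      using that zdvd_not_zless[of "a - 1" "int p"] zdvd_not_zless[of "a + 1" "int p"] by auto
    thus ?thesis using dvd_square_diff[of a 1] by (simp add: delta_def)
  qed
  have "(\<Sum>a\<in>U. delta a * F a) = (\<Sum>a\<in>{1, int p - 1}. delta a * F a)"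
    by (rule sum.mono_neutral_right) (use p_gt_2 zero in auto)
  also have "\<dots> = delta 1 * F 1 + delta (int p - 1) * F (int p - 1)" using p_gt_2 by simp
  also have "F (int p - 1) = F (-1)" by (rule periodicD[OF F]) (simp add: cong_iff_dvd_diff)
  also have "delta (int p - 1) = delta (-1)" by (rule delta_cong) (simp add: cong_iff_dvd_diff)
  finally show ?thesis by (simp add: even delta_def)
qed

text \<open>Evenness makes the points a = 1 and a = -1 contribute the same sum over b.\<close>

lemma sum_delta_left:
  assumes Y: "periodic Y" and even: "\<And>a. Y (- a) = Y a"
  shows "(\<Sum>a\<in>U. \<Sum>b\<in>U. delta a * X b * Y (a * b)) = 2 * (\<Sum>b\<in>U. X b * Y b)"
proof -
  have "periodic (\<lambda>a. \<Sum>b\<in>U. X b * Y (a * b))"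
    by (intro periodic_intros periodicI periodicD[OF Y])
  from sum_delta[OF this] show ?thesis
    by (simp add: even sum_distrib_left mult.assoc)
qed

lemma sum_delta_mid:
  assumes Y: "periodic Y" and even: "\<And>a. Y (- a) = Y a"
  shows "(\<Sum>a\<in>U. \<Sum>b\<in>U. X a * delta b * Y (a * b)) = 2 * (\<Sum>b\<in>U. X b * Y b)"
  unfolding sum_delta_left[OF assms, symmetric] by (subst sum.swap) (simp add: mult_ac)

text \<open>\<open>delta (a * b)\<close> selects a = 1/b and a = -1/b; scaling a by
  \<open>inv_mod b\<close> moves these points to 1 and -1.\<close>

lemma sum_delta_right:
  assumes X: "periodic X" and even: "\<And>a. X (- a) = X a"
  shows "(\<Sum>a\<in>U. \<Sum>b\<in>U. X a * Y b * delta (a * b)) = 2 * (\<Sum>b\<in>U. X (inv_mod b) * Y b)"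
proof -
  have "(\<Sum>a\<in>U. X a * delta (a * b)) = 2 * X (inv_mod b)" if "b \<in> U" for b
  proof -
    have b: "\<not> int p dvd b" using that by (rule U_not_dvd)
    have per: "periodic (\<lambda>a. X a * delta (a * b))"
      by (intro periodic_mult X periodicI delta_cong cong_mult cong_refl)
    have "(\<Sum>a\<in>U. X a * delta (a * b)) = (\<Sum>a\<in>U. X (inv_mod b * a) * delta (inv_mod b * a * b))"
      by (rule sum_scale_U[symmetric, OF per inv_mod_not_dvd[OF b]])
    also have "\<dots> = (\<Sum>a\<in>U. delta a * X (inv_mod b * a))"
    proof (rule sum.cong[OF refl])
      fix a
      have "[inv_mod b * a * b = a] (mod int p)"
        using cong_mult[OF cong_refl[of a] inv_mod[OF b]] by (simp add: mult_ac)
      from delta_cong[OF this]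
      show "X (inv_mod b * a) * delta (inv_mod b * a * b) = delta a * X (inv_mod b * a)" by simp
    qed
    also have "\<dots> = 2 * X (inv_mod b)"
      by (subst sum_delta) (auto simp: even intro!: periodicI periodicD[OF X] cong_mult)
    finally show ?thesis .
  qed
  hence "(\<Sum>b\<in>U. Y b * (\<Sum>a\<in>U. X a * delta (a * b))) = (\<Sum>b\<in>U. Y b * (2 * X (inv_mod b)))"
    by (intro sum.cong refl) simp
  thus ?thesis by (subst sum.swap) (simp add: sum_distrib_left mult_ac)
qed

lemma periodic_v: "periodic v" and periodic_v': "periodic v'" and periodic_delta: "periodic delta"
  unfolding v_def v'_def periodic_def by (auto dest: L_cong delta_cong)

lemma v_even: "v (- a) = v a" and v'_even: "v' (- a) = v' a" and delta_even: "delta (- a) = delta a"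
  by (simp_all add: v_def v'_def L_def delta_def)

section \<open>Sums of \<open>L\<close>, \<open>v\<close> and \<open>v'\<close>\<close>

lemma sum_U_delta: "(\<Sum>a\<in>U. delta a) = 2"
  using sum_delta[OF periodic_const[of 1]] by simp

text \<open>Factoring a^2 - 1 makes the complete sum a quadratic one of value -1, from which the
  term \<open>s\<close> at a = 0 is removed.\<close>

lemma sum_L: "(\<Sum>a\<in>U. L a) = - 1 - s"
proof -
  have "(\<Sum>a\<in>R. lam (a\<^sup>2 - 1)) = (\<Sum>a\<in>R. lam (a - 1) * lam (a - (-1)))"
    by (simp flip: lam_mult add: power2_eq_square algebra_simps)
  also have "\<dots> = -1"
    unfolding sum_lam_quadratic using not_dvd_2 by (simp add: cong_iff_dvd_diff)
  finally have "(\<Sum>a\<in>U. lam (a\<^sup>2 - 1)) = -1 - lam (-1)" by (simp add: sum_R)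
  hence "of_int (\<Sum>a\<in>U. lam (a\<^sup>2 - 1)) = - 1 - s" by (simp add: s_def)
  thus ?thesis by (simp add: L_def)
qed

lemma card_U: "(\<Sum>a\<in>U. 1) = (of_nat p - 1 :: complex)"
  using p_gt_2 by (simp add: of_nat_diff)

lemma sum_L_sq: "(\<Sum>a\<in>U. L a * L a) = of_nat p - 3"
  unfolding L_sq sum_subtractf sum_U_delta card_U by simp

text \<open>The product expands to s W^2 L^2 - (1 + s) W L + 1, and s W^2 = p.\<close>

lemma sum_v_v': "(\<Sum>a\<in>U. v a * v' a) = of_nat p * (of_nat p - 3) + (1 + s)\<^sup>2 * W + of_nat p - 1"
proof -
  have "(\<Sum>a\<in>U. v a * v' a) = (\<Sum>a\<in>U. (s * W\<^sup>2) * (L a * L a) - (1 + s) * W * L a + 1)"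
    by (intro sum.cong refl) (simp add: v_def v'_def algebra_simps power2_eq_square)
  also have "\<dots> = (s * W\<^sup>2) * (\<Sum>a\<in>U. L a * L a) - (1 + s) * W * (\<Sum>a\<in>U. L a) + (\<Sum>a\<in>U. 1)"
    by (simp only: sum.distrib sum_subtractf sum_distrib_left)
  also have "\<dots> = of_nat p * (of_nat p - 3) + (1 + s)\<^sup>2 * W + of_nat p - 1"
    unfolding sum_L_sq sum_L card_U W_square' by (simp add: algebra_simps power2_eq_square)
  finally show ?thesis .
qed

lemma sum_L_scale: "b \<in> U \<Longrightarrow> (\<Sum>a\<in>U. L (b * a)) = - 1 - s"
  using sum_scale_U[of L b] U_not_dvd by (simp add: sum_L periodicI L_cong)

text \<open>Of the eight monomials only the product of three values of \<open>L\<close> does not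
  reduce: it gives T. In the others the summations separate, since for fixed a or b the product a b
  again runs through the units.\<close>

lemma sum_v_v_v':
  "(\<Sum>a\<in>U. \<Sum>b\<in>U. v a * v b * v' (a * b))
     = W ^ 3 * of_int T_sum - W\<^sup>2 * (1 + 2 * s) * (1 + s)\<^sup>2 - (2 + s) * W * (of_nat p - 1) * (1 + s) - (of_nat p - 1)\<^sup>2"
proof -
  let ?l = "- 1 - s"
  let ?m = "of_nat p - 1 :: complex"
  \<comment> \<open>The factor \<open>s\<close> reverses the last difference, from a^2 b^2 - 1 to 1
    - a^2 b^2.\<close>
  have T: "s * (\<Sum>a\<in>U. \<Sum>b\<in>U. L a * L b * L (a * b)) = of_int T_sum"
    unfolding T_sum_def sum_distrib_left of_int_sum
  proof (intro sum.cong refl)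
    fix a b
    show "s * (L a * L b * L (a * b)) = of_int (lam (a\<^sup>2 - 1) * lam (b\<^sup>2 - 1) * lam (1 - a\<^sup>2 * b\<^sup>2))"
      unfolding lam_diff_commute[of 1] by (simp add: L_def s_def power_mult_distrib mult_ac)
  qed
  have 1: "(\<Sum>a\<in>U. \<Sum>b\<in>U. L a * L b) = ?l * ?l"
    unfolding sum_L[symmetric] sum_product ..
  have 2: "(\<Sum>a\<in>U. \<Sum>b\<in>U. L a * L (a * b)) = ?l * ?l"
  proof -
    have "(\<Sum>a\<in>U. \<Sum>b\<in>U. L a * L (a * b)) = (\<Sum>a\<in>U. L a * ?l)"
      by (intro sum.cong refl) (simp only: sum_L_scale flip: sum_distrib_left)
    thus ?thesis by (simp only: sum_L flip: sum_distrib_right)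
  qed
  have 3: "(\<Sum>a\<in>U. \<Sum>b\<in>U. L b * L (a * b)) = ?l * ?l"
    by (subst sum.swap) (simp add: 2 mult.commute)
  have 4: "(\<Sum>a\<in>U. \<Sum>b\<in>U. L a) = ?m * ?l"
    by (subst sum.swap) (simp only: sum_L card_U[symmetric] sum_distrib_right mult_1_left)
  have 5: "(\<Sum>a\<in>U. \<Sum>b\<in>U. L b) = ?m * ?l"
    by (subst sum.swap) (rule 4)
  have 6: "(\<Sum>a\<in>U. \<Sum>b\<in>U. L (a * b)) = ?m * ?l"
    unfolding card_U[symmetric] sum_distrib_right by (intro sum.cong refl) (simp add: sum_L_scale)
  have 7: "(\<Sum>a\<in>U. \<Sum>b\<in>U. 1) = ?m * ?m"
    unfolding card_U[symmetric] sum_product by simp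
  have "(\<Sum>a\<in>U. \<Sum>b\<in>U. v a * v b * v' (a * b))
    = (\<Sum>a\<in>U. \<Sum>b\<in>U. W ^ 3 * s * (L a * L b * L (a * b)) - W\<^sup>2 * (L a * L b)
        - s * W\<^sup>2 * (L a * L (a * b)) - s * W\<^sup>2 * (L b * L (a * b))
        + W * L a + W * L b + s * W * L (a * b) - 1)"
    by (intro sum.cong refl) (simp add: v_def v'_def algebra_simps power2_eq_square power3_eq_cube)
  also have "\<dots> = W ^ 3 * s * (\<Sum>a\<in>U. \<Sum>b\<in>U. L a * L b * L (a * b)) - W\<^sup>2 * (\<Sum>a\<in>U. \<Sum>b\<in>U. L a * L b)
        - s * W\<^sup>2 * (\<Sum>a\<in>U. \<Sum>b\<in>U. L a * L (a * b)) - s * W\<^sup>2 * (\<Sum>a\<in>U. \<Sum>b\<in>U. L b * L (a * b))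
        + W * (\<Sum>a\<in>U. \<Sum>b\<in>U. L a) + W * (\<Sum>a\<in>U. \<Sum>b\<in>U. L b) + s * W * (\<Sum>a\<in>U. \<Sum>b\<in>U. L (a * b))
        - (\<Sum>a\<in>U. \<Sum>b\<in>U. 1)"
    by (simp only: sum.distrib sum_subtractf sum_distrib_left)
  also have "\<dots> = W ^ 3 * of_int T_sum - W\<^sup>2 * (?l * ?l) - s * W\<^sup>2 * (?l * ?l) - s * W\<^sup>2 * (?l * ?l)
        + W * (?m * ?l) + W * (?m * ?l) + s * W * (?m * ?l) - ?m * ?m"
    unfolding mult.assoc[of "W ^ 3"] T 1 2 3 4 5 6 7 ..
  also have "\<dots> = W ^ 3 * of_int T_sum - W\<^sup>2 * (1 + 2 * s) * (1 + s)\<^sup>2 - (2 + s) * W * ?m * (1 + s) - ?m\<^sup>2"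
    by (simp add: algebra_simps power2_eq_square)
  finally show ?thesis .
qed

text \<open>The \<open>delta\<close> term of \<open>c\<close> is split off one factor at a time, so
  three of the four resulting sums contain a \<open>delta\<close> and collapse to single sums; the
  fourth is \<open>sum_v_v_v'\<close>.\<close>

lemma N_eq:
  "N = 4 * of_nat p ^ 3 - 12 * of_nat p ^ 2
     + 6 * of_nat p * (of_nat p * (of_nat p - 3) + (1 + s)\<^sup>2 * W + of_nat p - 1)
     + W ^ 3 * of_int T_sum - W\<^sup>2 * (1 + 2 * s) * (1 + s)\<^sup>2 - (2 + s) * W * (of_nat p - 1) * (1 + s)
     - (of_nat p - 1)\<^sup>2"
proof -
  let ?p = "of_nat p :: complex"
  define c' where "c' = (\<lambda>a. ?p * delta a + v' a)"
  define V where "V = (\<Sum>a\<in>U. v a * v' a)"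
  have c': "periodic c'" "\<And>a. c' (- a) = c' a"
    using periodic_v' periodic_delta by (auto simp: c'_def v'_even delta_even periodic_def)
  \<comment> \<open>Where \<open>delta\<close> is nonzero, \<open>L\<close> vanishes, so
    \<open>v\<close> and \<open>v'\<close> equal -1.\<close>
  have dv: "delta a * v a = - delta a" "delta a * v' a = - delta a" for a
    using delta_L[of a] by (auto simp: v_def v'_def algebra_simps)
  have "N = (\<Sum>a\<in>U. \<Sum>b\<in>U. c a * c b * c' (a * b))"
    unfolding N_def
  proof (intro sum.cong refl arg_cong2[of _ _ _ _ "(*)"])
    fix a b assume "a \<in> U" "b \<in> U"
    hence "\<not> int p dvd a * b" using U_not_dvd prime_dvd_mult_iff[OF prime_int_p] by blast
    thus "c (inv_mod (a * b)) = c' (a * b)" by (simp add: c_inv c'_def)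
  qed
  also have "\<dots> = (\<Sum>a\<in>U. \<Sum>b\<in>U. ?p * (delta a * c b * c' (a * b)) + ?p * (v a * delta b * c' (a * b))
         + ?p * (v a * v b * delta (a * b)) + v a * v b * v' (a * b))"
    by (intro sum.cong refl) (simp add: c_eq c'_def algebra_simps)
  also have "\<dots> = ?p * (\<Sum>a\<in>U. \<Sum>b\<in>U. delta a * c b * c' (a * b)) + ?p * (\<Sum>a\<in>U. \<Sum>b\<in>U. v a * delta b * c' (a * b))
         + ?p * (\<Sum>a\<in>U. \<Sum>b\<in>U. v a * v b * delta (a * b)) + (\<Sum>a\<in>U. \<Sum>b\<in>U. v a * v b * v' (a * b))"
    by (simp only: sum.distrib sum_distrib_left)
  also have "\<dots> = ?p * (2 * (\<Sum>b\<in>U. c b * c' b)) + ?p * (2 * (\<Sum>b\<in>U. v b * c' b))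
         + ?p * (2 * (\<Sum>b\<in>U. v (inv_mod b) * v b)) + (\<Sum>a\<in>U. \<Sum>b\<in>U. v a * v b * v' (a * b))"
    by (simp only: sum_delta_left[OF c'] sum_delta_mid[OF c'] sum_delta_right[OF periodic_v v_even])
  also have "(\<Sum>b\<in>U. c b * c' b) = (?p\<^sup>2 - 2 * ?p) * (\<Sum>b\<in>U. delta b) + V"
    unfolding V_def sum_distrib_left sum.distrib[symmetric]
  proof (intro sum.cong refl)
    fix b
    have "c b * c' b = ?p\<^sup>2 * (delta b * delta b) + ?p * (delta b * v b) + ?p * (delta b * v' b) + v b * v' b"
      by (simp add: c_eq c'_def algebra_simps power2_eq_square)
    thus "c b * c' b = (?p\<^sup>2 - 2 * ?p) * delta b + v b * v' b"
      unfolding dv delta_sq by (simp add: algebra_simps)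
  qed
  also have "(\<Sum>b\<in>U. v b * c' b) = - ?p * (\<Sum>b\<in>U. delta b) + V"
    unfolding V_def sum_distrib_left sum.distrib[symmetric]
  proof (intro sum.cong refl)
    fix b
    have "v b * c' b = ?p * (delta b * v b) + v b * v' b" by (simp add: c'_def algebra_simps)
    thus "v b * c' b = - ?p * delta b + v b * v' b" unfolding dv by simp
  qed
  also have "(\<Sum>b\<in>U. v (inv_mod b) * v b) = V"
    unfolding V_def by (intro sum.cong refl) (simp add: v_inv U_not_dvd mult.commute)
  \<comment> \<open>As \<open>delta\<close> sums to 2, the explicit part is 4p (p^2 - 2p) - 4p^2,
    and \<open>V\<close> occurs three times with the factor 2p.\<close>
  finally have "N = 4 * ?p ^ 3 - 12 * ?p ^ 2 + 6 * ?p * V + (\<Sum>a\<in>U. \<Sum>b\<in>U. v a * v b * v' (a * b))"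
    by (simp add: sum_U_delta algebra_simps power2_eq_square power3_eq_cube)
  thus ?thesis unfolding V_def sum_v_v' sum_v_v_v' by (simp add: algebra_simps)
qed

section \<open>The two residue classes modulo 4\<close>

lemma lam_minus_1_1mod4:
  assumes "p mod 4 = 1"
  shows "lam (-1) = 1"
proof -
  have "even ((p - 1) div 2)" using assms by presburger
  hence "int p dvd lam (-1) - 1" using lam_euler[of "-1"] by (simp add: cong_iff_dvd_diff)
  thus ?thesis using lam_cases[of "-1"] p_gt_2 zdvd_imp_le[of "int p" 2] by auto
qed

lemma lam_minus_1_3mod4:
  assumes "p mod 4 = 3"
  shows "lam (-1) = -1"
proof -
  have "odd ((p - 1) div 2)" using assms by presburger
  hence "int p dvd lam (-1) + 1" using lam_euler[of "-1"] by (simp add: cong_iff_dvd_diff)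
  thus ?thesis using lam_cases[of "-1"] p_gt_2 zdvd_imp_le[of "int p" 2] by auto
qed

text \<open>Here s = -1, so T and all terms with a factor 1 + s vanish; what remains of
  \<open>N\<close> is 4p^3 - 12p^2 + 6p (p^2 - 2p - 1) - (p - 1)^2.\<close>

lemma sixth_moment_3mod4:
  assumes "p mod 4 = 3"
  shows "(\<Sum>\<chi>\<in>dirichlet_characters p. norm (gen_gauss_sum n \<chi> p) ^ 6)
       = (real p - 1) * (10 * real p ^ 3 - 25 * real p ^ 2 - 4 * real p - 1)"
proof -
  have l: "lam (-1) = -1" by (rule lam_minus_1_3mod4[OF assms])
  hence "N = of_real (10 * real p ^ 3 - 25 * real p ^ 2 - 4 * real p - 1)"
    unfolding N_eq T_sum_eq_0[OF l] by (simp add: s_def algebra_simps power2_eq_square power3_eq_cube)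
  hence "complex_of_real (\<Sum>\<chi>\<in>dirichlet_characters p. norm (gen_gauss_sum n \<chi> p) ^ 6)
      = complex_of_real (real (p - 1) * (10 * real p ^ 3 - 25 * real p ^ 2 - 4 * real p - 1))"
    unfolding sixth_moment_eq by simp
  hence "(\<Sum>\<chi>\<in>dirichlet_characters p. norm (gen_gauss_sum n \<chi> p) ^ 6)
      = real (p - 1) * (10 * real p ^ 3 - 25 * real p ^ 2 - 4 * real p - 1)"
    by (simp only: of_real_eq_iff)
  thus ?thesis using p_gt_2 by (simp add: of_nat_diff)
qed

text \<open>With s = 1, \<open>N\<close> is 10 p^3 plus errors, of which W^3 T has the largest
  order, being at most 12 p^(5/2); the factor p - 1 raises the exponent to 7/2.\<close>

lemma sixth_moment_1mod4:
  assumes "p mod 4 = 1"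
  shows "\<bar>(\<Sum>\<chi>\<in>dirichlet_characters p. norm (gen_gauss_sum n \<chi> p) ^ 6) - 10 * real p ^ 4\<bar>
       \<le> 94 * real p powr (7/2)"
proof -
  define S where "S = (\<Sum>\<chi>\<in>dirichlet_characters p. norm (gen_gauss_sum n \<chi> p) ^ 6)"
  \<comment> \<open>Working with the square root keeps all exponents integral: \<open>norm W\<close>
    is q and p is q^2.\<close>
  define q where "q = sqrt (real p)"
  have pq: "real p = q\<^sup>2" and q1: "1 \<le> q" using p_gt_2 by (auto simp: q_def)
  have s: "s = 1" using lam_minus_1_1mod4[OF assms] by (simp add: s_def)
  let ?p = "of_nat p :: complex"
  have Neq: "N - 10 * ?p ^ 3 = - (25 * ?p\<^sup>2) - 4 * ?p - 1 + 24 * ?p * W + W ^ 3 * of_int T_sum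
      - 12 * W\<^sup>2 - 6 * W * (?p - 1)"
    unfolding N_eq s by (simp add: algebra_simps power2_eq_square power3_eq_cube)
  have T: "norm (complex_of_int T_sum) \<le> 12 * q\<^sup>2"
    using T_sum_bound unfolding pq[symmetric] norm_of_int by linarith
  have p1: "norm (?p - 1) \<le> q\<^sup>2"
  proof -
    have "norm (?p - 1) = real (p - 1)" using p_gt_2 by (metis norm_of_nat of_nat_1 of_nat_diff le_trans less_imp_le one_le_numeral)
    thus ?thesis using pq by linarith
  qed
  have nW: "norm W = q" by (simp add: norm_W q_def)
  have np: "norm ?p = q\<^sup>2" by (simp add: pq)
  have "norm (N - 10 * ?p ^ 3) \<le> norm (25 * ?p\<^sup>2) + norm (4 * ?p) + norm (1 :: complex) + norm (24 * ?p * W)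
      + norm (W ^ 3 * of_int T_sum) + norm (12 * W\<^sup>2) + norm (6 * W * (?p - 1))"
    unfolding Neq
    by (intro order_trans[OF norm_triangle_ineq4] order_trans[OF norm_triangle_ineq] add_mono order_refl)
       (simp_all only: norm_minus_cancel order_refl)
  also have "\<dots> \<le> 25 * q ^ 4 + 4 * q\<^sup>2 + 1 + 24 * q ^ 3 + q ^ 3 * (12 * q\<^sup>2) + 12 * q\<^sup>2 + 6 * q * q\<^sup>2"
  proof -
    have "norm (25 * ?p\<^sup>2) = 25 * q ^ 4" "norm (24 * ?p * W) = 24 * q ^ 3"
      by (simp_all add: norm_mult norm_power np nW pq flip: power_mult) (simp add: power2_eq_square power3_eq_cube)
    moreover have "norm (4 * ?p) = 4 * q\<^sup>2" "norm (12 * W\<^sup>2) = 12 * q\<^sup>2" "norm (1 :: complex) = 1"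
      by (simp_all add: norm_mult norm_power np nW pq)
    moreover have "norm (W ^ 3 * of_int T_sum) \<le> q ^ 3 * (12 * q\<^sup>2)"
      unfolding norm_mult norm_power nW using T q1 by (intro mult_left_mono) auto
    moreover have "norm (6 * W * (?p - 1)) \<le> 6 * q * q\<^sup>2"
      unfolding norm_mult nW using p1 q1 by (simp add: mult_left_mono)
    ultimately show ?thesis by linarith
  qed
  \<comment> \<open>As q \<ge> 1, every power is at most q^5, and the coefficients 25, 4, 1, 24, 12,
    12 and 6 add up to 84.\<close>
  also have "\<dots> \<le> 84 * q ^ 5"
  proof -
    have "q ^ i \<le> q ^ 5" if "i \<le> 5" for i using q1 that by (rule power_increasing[rotated])
    from this[of 4] this[of 3] this[of 2] this[of 0]
    show ?thesis by (simp add: power_add[symmetric] power2_eq_square numeral_eq_Suc algebra_simps)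
  qed
  finally have Nb: "norm (N - 10 * ?p ^ 3) \<le> 84 * q ^ 5" .
  \<comment> \<open>The factor p - 1 in place of p leaves a further 10 p^3 = 10 q^6, which raises
    the constant from 84 to 94.\<close>
  have "complex_of_real (S - 10 * real p ^ 4) = (?p - 1) * (N - 10 * ?p ^ 3) - 10 * ?p ^ 3"
    using sixth_moment_eq p_gt_2
    by (simp add: S_def of_nat_diff algebra_simps power3_eq_cube power4_eq_xxxx)
  hence "\<bar>S - 10 * real p ^ 4\<bar> = norm ((?p - 1) * (N - 10 * ?p ^ 3) - 10 * ?p ^ 3)"
    by (metis norm_of_real real_norm_def)
  also have "\<dots> \<le> norm (?p - 1) * norm (N - 10 * ?p ^ 3) + norm (10 * ?p ^ 3)"
    by (rule order_trans[OF norm_triangle_ineq4]) (simp add: norm_mult)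
  also have "\<dots> \<le> q\<^sup>2 * (84 * q ^ 5) + 10 * q ^ 6"
    using q1 by (intro add_mono mult_mono p1 Nb) (auto simp: norm_mult norm_power pq simp flip: power_mult)
  also have "\<dots> \<le> 94 * q ^ 7"
  proof -
    have eq: "q ^ 7 = q\<^sup>2 * q ^ 5" using power_add[of q 2 5] by simp
    have "q\<^sup>2 * (84 * q ^ 5) = 84 * q ^ 7" unfolding eq by simp
    thus ?thesis using power_increasing[of 6 7 q] q1 by linarith
  qed
  also have "q ^ 7 = real p powr (7/2)"
    using p_gt_2 by (simp add: q_def powr_half_sqrt[symmetric] powr_powr flip: powr_realpow)
  finally show ?thesis unfolding S_def .
qed

end

theorem theorem6:
  shows "(\<exists>C::real. \<forall>(p::nat) (n::int).
            prime p \<and> p mod 4 = 1 \<and> coprime n (int p) \<longrightarrow>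
            \<bar>(\<Sum>\<chi>\<in>dirichlet_characters p. cmod (gen_gauss_sum n \<chi> p) ^ 6) - 10 * real p ^ 4\<bar>
              \<le> C * real p powr (7/2))
       \<and> (\<forall>(p::nat) (n::int).
            prime p \<and> p mod 4 = 3 \<and> coprime n (int p) \<longrightarrow>
            (\<Sum>\<chi>\<in>dirichlet_characters p. cmod (gen_gauss_sum n \<chi> p) ^ 6)
              = (real p - 1) * (10 * real p ^ 3 - 25 * real p ^ 2 - 4 * real p - 1))"
proof -
  have modulus: "gauss_modulus p n" if "prime p" "p mod 4 = 1 \<or> p mod 4 = 3" "coprime n (int p)" for p n
  proof
    show "prime p" by fact
    have "p \<noteq> 2" using that(2) by auto
    thus "p > 2" using prime_ge_2_nat[OF that(1)] by simp
    show "\<not> int p dvd n"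
      using that(1,3) by (metis coprime_common_divisor dvd_refl not_prime_unit prime_nat_int_transfer)
  qed
  show ?thesis
  proof (intro conjI exI[of _ "94::real"] allI impI; elim conjE)
    fix p :: nat and n :: int
    assume p: "prime p" "p mod 4 = 1" "coprime n (int p)"
    then interpret gauss_modulus p n by (intro modulus) auto
    show "\<bar>(\<Sum>\<chi>\<in>dirichlet_characters p. cmod (gen_gauss_sum n \<chi> p) ^ 6) - 10 * real p ^ 4\<bar>
        \<le> 94 * real p powr (7/2)"
      by (rule sixth_moment_1mod4[OF p(2)])
  next
    fix p :: nat and n :: int
    assume p: "prime p" "p mod 4 = 3" "coprime n (int p)"
    then interpret gauss_modulus p n by (intro modulus) auto
    show "(\<Sum>\<chi>\<in>dirichlet_characters p. cmod (gen_gauss_sum n \<chi> p) ^ 6)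
        = (real p - 1) * (10 * real p ^ 3 - 25 * real p ^ 2 - 4 * real p - 1)"
      by (rule sixth_moment_3mod4[OF p(2)])
  qed
qed

end
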